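(* Let $K$ and $L$ be compact Hausdorff spaces, let $T:C(K)\to C(L)$ be a positive isomorphic embedding, and suppose that $L$ is Corson compact. Then $K$ has a $\pi$-base of sets having Corson compact closures. If, moreover, $K$ is homogeneous, then $K$ is Corson compact itself.
   Context: $C(K)$ is the Banach space of real-valued continuous functions on $K$ with the supremum norm. An isomorphic embedding $T:C(K)\to C(L)$ is a linear operator (not necessarily surjective) for which there are constants $m_1,m_2>0$ with $m_1\|g\|\le\|Tg\|\le m_2\|g\|$ for all $g\in C(K)$. $T$ is positive if $g\ge 0$ implies $Tg\ge 0$. A compact space is Corson compact if, for some cardinal $\kappa$, it is homeomorphic to a subset of $\Sigma(\mathbb{R}^\kappa)=\{x\in\mathbb{R}^\kappa: |\{\alpha: x_\alpha\ne 0\}|\le\omega\}$ (with the topology inherited from the product $\mathbb{R}^\kappa$). A $\pi$-base of $K$ is a family of nonempty open subsets of $K$ such that every nonempty open subset of $K$ contains a member of the family. $K$ is homogeneous if for each pair $x_1,x_2\in K$ there is a homeomorphism $\theta:K\to K$ with $\theta(x_1)=x_2$. *)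

theory Defs
  imports "HOL-Analysis.Analysis"
begin

text \<open>
  For a compact Hausdorff space \<open>'k\<close>, the Banach space \<open>C(K)\<close> is the library type
  \<open>'k \<Rightarrow>\<^sub>C real\<close> of bounded continuous functions with the supremum norm: every continuous
  real function on a compact space is bounded.
\<close>

definition isomorphic_embedding ::
    "('a::real_normed_vector \<Rightarrow> 'b::real_normed_vector) \<Rightarrow> bool" where
  "isomorphic_embedding T \<longleftrightarrow> linear T \<and>
     (\<exists>m1 m2 :: real. 0 < m1 \<and> 0 < m2 \<and>
        (\<forall>g. m1 * norm g \<le> norm (T g) \<and> norm (T g) \<le> m2 * norm g))"

definition positive_operator ::
    "(('k::topological_space \<Rightarrow>\<^sub>C real) \<Rightarrow> ('l::topological_space \<Rightarrow>\<^sub>C real)) \<Rightarrow> bool" where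
  "positive_operator T \<longleftrightarrow>
     (\<forall>g. (\<forall>x. 0 \<le> apply_bcontfun g x) \<longrightarrow> (\<forall>y. 0 \<le> apply_bcontfun (T g) y))"

definition Sigma_product :: "'i set \<Rightarrow> ('i \<Rightarrow> real) set" where
  "Sigma_product I =
     {x \<in> topspace (product_topology (\<lambda>_. euclideanreal) I). countable {i \<in> I. x i \<noteq> 0}}"

definition Sigma_embeddable :: "'i set \<Rightarrow> 'a topology \<Rightarrow> bool" where
  "Sigma_embeddable I X \<longleftrightarrow>
     (\<exists>S \<subseteq> Sigma_product I.
        X homeomorphic_space subtopology (product_topology (\<lambda>_. euclideanreal) I) S)"

text \<open>
  HOL cannot quantify over all cardinals \<open>\<kappa>\<close> of arbitrary types, so \<open>\<kappa>\<close> is represented by a set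
  \<open>I\<close> of functions \<open>'a \<Rightarrow> real\<close>. By \<open>Corson_compactI\<close> below this is no restriction: an index
  set of any type yields an index set of this one, because equal coordinate functions of an
  embedding can be merged.
\<close>

definition Corson_compact :: "'a topology \<Rightarrow> bool" where
  "Corson_compact X \<longleftrightarrow>
     compact_space X \<and> (\<exists>I :: ('a \<Rightarrow> real) set. Sigma_embeddable I X)"

lemma Corson_compactI:
  fixes X :: "'a topology" and I :: "'i set"
  assumes X: "compact_space X" and emb: "Sigma_embeddable I X"
  shows "Corson_compact X"
proof -
  obtain S h where S: "S \<subseteq> Sigma_product I"
    and h: "homeomorphic_map X (subtopology (product_topology (\<lambda>_. euclideanreal) I) S) h"
    using emb unfolding Sigma_embeddable_def homeomorphic_space by blast
  have hcont: "continuous_map X (product_topology (\<lambda>_. euclideanreal) I) h"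
    using homeomorphic_imp_continuous_map[OF h] by (simp add: continuous_map_in_subtopology)
  have hinj: "inj_on h (topspace X)"
    using homeomorphic_imp_injective_map[OF h] .
  have hS: "h ` topspace X \<subseteq> Sigma_product I"
    using homeomorphic_imp_surjective_map[OF h] S by auto
  define \<phi> where "\<phi> i = (\<lambda>x. h x i)" for i
  define J where "J = \<phi> ` I"
  define k where "k x = (\<lambda>f\<in>J. f x)" for x
  have kcont: "continuous_map X (product_topology (\<lambda>_. euclideanreal) J) k"
    using hcont by (auto simp: continuous_map_componentwise k_def J_def \<phi>_def)
  have kinj: "inj_on k (topspace X)"
  proof (rule inj_onI)
    fix x y assume xy: "x \<in> topspace X" "y \<in> topspace X" "k x = k y"
    have "h x i = h y i" if "i \<in> I" for i
      using fun_cong[OF xy(3), of "\<phi> i"] that by (simp add: k_def J_def \<phi>_def)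
    moreover have "h x \<in> extensional I" "h y \<in> extensional I"
      using hS xy by (auto simp: Sigma_product_def PiE_def)
    ultimately have "h x = h y" by (metis extensionalityI)
    then show "x = y" using hinj xy by (auto dest: inj_onD)
  qed
  have "k x \<in> Sigma_product J" if x: "x \<in> topspace X" for x
  proof -
    have "countable {i \<in> I. h x i \<noteq> 0}"
      using hS x by (auto simp: Sigma_product_def)
    moreover have "{f \<in> J. k x f \<noteq> 0} \<subseteq> \<phi> ` {i \<in> I. h x i \<noteq> 0}"
      by (auto simp: k_def J_def \<phi>_def)
    ultimately have "countable {f \<in> J. k x f \<noteq> 0}"
      by (meson countable_image countable_subset)
    then show ?thesis by (simp add: Sigma_product_def k_def)
  qed
  then have sub: "k ` topspace X \<subseteq> Sigma_product J" by blast
  let ?Y = "subtopology (product_topology (\<lambda>_. euclideanreal) J) (k ` topspace X)"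
  have "topspace ?Y = k ` topspace X"
    using sub by (auto simp: Sigma_product_def)
  then have "homeomorphic_map X ?Y k"
    using X kcont kinj
    by (intro continuous_imp_homeomorphic_map)
      (auto simp: continuous_map_in_subtopology Hausdorff_space_subtopology
        Hausdorff_space_product_topology)
  then show ?thesis
    using X sub unfolding Corson_compact_def Sigma_embeddable_def homeomorphic_space by blast
qed

definition pi_base :: "'a topology \<Rightarrow> 'a set set \<Rightarrow> bool" where
  "pi_base X \<B> \<longleftrightarrow>
     (\<forall>U\<in>\<B>. openin X U \<and> U \<noteq> {}) \<and>
     (\<forall>V. openin X V \<and> V \<noteq> {} \<longrightarrow> (\<exists>U\<in>\<B>. U \<subseteq> V))"

definition homogeneous_space :: "'a topology \<Rightarrow> bool" where
  "homogeneous_space X \<longleftrightarrow>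
     (\<forall>x1\<in>topspace X. \<forall>x2\<in>topspace X. \<exists>\<theta>. homeomorphic_map X X \<theta> \<and> \<theta> x1 = x2)"

end

theory Submission
  imports Defs
begin

text \<open>
  The proof turns the operator into a continuous map between subsets of the spaces, and then
  uses that Corson compacta are preserved by continuous maps onto Hausdorff spaces.

  \<^emph>\<open>From the operator to a map.\<close> For \<open>y \<in> L\<close> the functional \<open>g \<mapsto> (T g)(y)\<close> is a positive measure on
  \<open>K\<close> of mass at most \<open>M\<close>, and it depends continuously on \<open>y\<close>. If \<open>m \<parallel>g\<parallel> \<le> \<parallel>T g\<parallel>\<close>, then every point
  \<open>x \<in> K\<close> is an atom of mass at least \<open>m\<close> of one of these measures: bumps concentrating at \<open>x\<close>
  have images of norm at least \<open>m\<close>, and \<open>L\<close> is compact (\<open>exists_charging\<close>). So \<open>K\<close> is covered by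
  the values of a set-valued map with closed graph that sends \<open>y\<close> to the finite set of points charged
  by \<open>y\<close>. Inside any nonempty open set there is a nonempty open \<open>U\<close> and a closed \<open>L' \<subseteq> L\<close> that
  still covers \<open>U\<close> and on which this map is single-valued (\<open>uniquely_charged_open_set\<close>). Otherwise
  some \<open>y\<close> charges two points of \<open>U\<close>; by continuity all measures near \<open>y\<close> have mass more than \<open>m/2\<close>
  around both points, and if the covering set was chosen minimal, some smaller open set is covered
  by these measures only. That open set can be taken to miss a neighbourhood of one of the two
  points, so the mass available on it is lower by \<open>m/2\<close>, which can happen only finitely often.
  Consequently a compact subset of \<open>L\<close> maps continuously onto the closure of a nonempty open set.

  \<^emph>\<open>Continuous images.\<close> Let \<open>S\<close> be a compact set of points with countable support in a power of the
  line and let \<open>f\<close> map \<open>S\<close> continuously onto a Hausdorff space. For a set \<open>J\<close> of coordinates let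
  \<open>restr J y\<close> be \<open>y\<close> with all coordinates off \<open>J\<close> replaced by 0. There is a closure operator on sets of
  coordinates, generated by countably many new coordinates for each finite set, such that for each
  closed \<open>J\<close> the restriction maps \<open>S\<close> to itself and respects the fibres of \<open>f\<close>
  (\<open>exists_compatibility_closure\<close>); it hence induces a retraction of the image. Writing a closed \<open>J\<close>
  as the union of a continuous increasing chain of smaller closed sets, a point-countable separating
  family for \<open>J\<close> is obtained from the families for the members of the chain: a family at one stage
  is applied to the difference between consecutive retractions, and a point of countable support sees
  only countably many nonzero differences (\<open>image_sigma_family_step\<close>). The induction on the
  cardinality of \<open>J\<close> starts with countable \<open>J\<close>, where the image is metrizable.

  \<^emph>\<open>Homogeneous spaces.\<close> If \<open>K\<close> is homogeneous, one nonempty open set with Corson compact closure can be moved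
  to any point, and finitely many separating families are glued along bump functions.
\<close>

section \<open>Closure under a countable-valued finitary operation\<close>

unbundle cardinal_syntax

definition closed_under :: "('i set \<Rightarrow> 'i set) \<Rightarrow> 'i set \<Rightarrow> bool" where
  "closed_under c J \<longleftrightarrow> (\<forall>F. finite F \<and> F \<subseteq> J \<longrightarrow> c F \<subseteq> J)"

lemma closed_under_hull: "closed_under c (closed_under c hull A)"
proof (rule hull_in)
  fix T assume "\<forall>J\<in>T. closed_under c J"
  then show "closed_under c (\<Inter>T)" unfolding closed_under_def by (meson Inter_greatest Inter_lower order_trans)
qed

lemma finite_subset_directed_Union:
  assumes "finite F" "F \<subseteq> \<Union>\<C>" "\<C> \<noteq> {}"
    and dir: "\<And>A B. A \<in> \<C> \<Longrightarrow> B \<in> \<C> \<Longrightarrow> \<exists>C\<in>\<C>. A \<union> B \<subseteq> C"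
  shows "\<exists>A\<in>\<C>. F \<subseteq> A"
  using assms(1,2)
proof (induction F rule: finite_induct)
  case empty
  then show ?case using \<open>\<C> \<noteq> {}\<close> by blast
next
  case (insert x F)
  from insert obtain A where "A \<in> \<C>" "F \<subseteq> A" by auto
  moreover from insert.prems obtain B where "B \<in> \<C>" "x \<in> B" by auto
  ultimately show ?case using dir[of A B] by auto
qed

lemma closed_under_directed_Union:
  assumes "\<C> \<noteq> {}"
    and "\<And>A B. A \<in> \<C> \<Longrightarrow> B \<in> \<C> \<Longrightarrow> \<exists>C\<in>\<C>. A \<union> B \<subseteq> C"
    and "\<And>A. A \<in> \<C> \<Longrightarrow> closed_under c A"
  shows "closed_under c (\<Union>\<C>)"
  unfolding closed_under_def
proof (intro allI impI, elim conjE)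
  fix F assume F: "finite F" "F \<subseteq> \<Union>\<C>"
  then obtain A where "A \<in> \<C>" "F \<subseteq> A"
    using finite_subset_directed_Union[OF F assms(1,2)] by blast
  then show "c F \<subseteq> \<Union>\<C>" using assms(3)[of A] F by (auto simp: closed_under_def)
qed

text \<open>
  A finite subset is the set of entries of a list, and the lists of each fixed length are bounded
  by the absorption law for products of infinite cardinals.
\<close>
lemma card_of_finite_subsets_ordLeq:
  assumes inf: "infinite B" and AB: "|A| \<le>o |B|"
  shows "|{F. finite F \<and> F \<subseteq> A}| \<le>o |B|"
proof -
  define L where "L n = {xs \<in> lists A. length xs = n}" for n
  have L: "|L n| \<le>o |B|" for n
  proof (induction n)
    case 0
    have "L 0 = {[]}" by (auto simp: L_def)
    moreover have "B \<noteq> {}" using inf by auto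
    ultimately show ?case by (simp add: card_of_singl_ordLeq)
  next
    case (Suc n)
    have "L (Suc n) \<subseteq> (\<lambda>(a, l). a # l) ` (A \<times> L n)"
    proof
      fix xs assume "xs \<in> L (Suc n)"
      then obtain a l where "xs = a # l" "a \<in> A" "l \<in> L n"
        by (cases xs) (auto simp: L_def)
      then show "xs \<in> (\<lambda>(a, l). a # l) ` (A \<times> L n)" by force
    qed
    then have "|L (Suc n)| \<le>o |A \<times> L n|" by (rule surj_imp_ordLeq)
    moreover have "|A \<times> L n| \<le>o |B|"
      by (rule card_of_Sigma_ordLeq_infinite) (use inf AB Suc in auto)
    ultimately show ?case using ordLeq_transitive by blast
  qed
  have "{F. finite F \<and> F \<subseteq> A} \<subseteq> set ` (\<Union>n\<in>UNIV. L n)"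
  proof
    fix F assume "F \<in> {F. finite F \<and> F \<subseteq> A}"
    then obtain xs where "set xs = F" "F \<subseteq> A" using finite_list by blast
    then have "xs \<in> L (length xs)" by (auto simp: L_def)
    then show "F \<in> set ` (\<Union>n\<in>UNIV. L n)" using \<open>set xs = F\<close> by blast
  qed
  then have "|{F. finite F \<and> F \<subseteq> A}| \<le>o |\<Union>n\<in>UNIV. L n|" by (rule surj_imp_ordLeq)
  moreover have "|\<Union>n\<in>(UNIV::nat set). L n| \<le>o |B|"
    using inf L by (simp add: card_of_UNION_ordLeq_infinite infinite_iff_card_of_nat)
  ultimately show ?thesis by (rule ordLeq_transitive)
qed

lemma countable_iff_ordLeq_nat: "countable A \<longleftrightarrow> |A| \<le>o |UNIV :: nat set|"
  unfolding countable_def card_of_ordLeq[symmetric] by blast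

lemma finite_ordLess_infinite_set: "finite A \<Longrightarrow> infinite B \<Longrightarrow> |A| <o |B|"
  using card_of_ordLeq_finite[of B A]
  by (auto simp: not_ordLeq_iff_ordLess[OF card_of_Well_order card_of_Well_order, symmetric])

lemma countable_ordLeq_infinite: "countable A \<Longrightarrow> infinite B \<Longrightarrow> |A| \<le>o |B|"
  using ordLeq_transitive[of "|A|" "|UNIV :: nat set|" "|B|"]
  by (simp add: countable_iff_ordLeq_nat infinite_iff_card_of_nat)

text \<open>
  Since the operation is finitary, the hull is reached after countably many rounds, each of which
  adds countably many elements for every finite subset of the current stage.
\<close>
lemma card_of_hull_ordLeq:
  assumes inf: "infinite B" and AB: "|A| \<le>o |B|"
    and c: "\<And>F. finite F \<Longrightarrow> countable (c F)"
  shows "|closed_under c hull A| \<le>o |B|"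
proof -
  define step where "step X = X \<union> (\<Union>F\<in>{F. finite F \<and> F \<subseteq> X}. c F)" for X
  define C where "C n = (step ^^ n) A" for n
  have C_Suc: "C (Suc n) = step (C n)" for n by (simp add: C_def)
  have "|C n| \<le>o |B|" for n
  proof (induction n)
    case (Suc n)
    have "|\<Union>F\<in>{F. finite F \<and> F \<subseteq> C n}. c F| \<le>o |B|"
      by (rule card_of_UNION_ordLeq_infinite[OF inf card_of_finite_subsets_ordLeq[OF inf Suc]])
        (simp add: c countable_ordLeq_infinite[OF _ inf])
    from card_of_Un_ordLeq_infinite_Field[OF _ Suc this card_of_Card_order] inf
    show ?case by (simp add: C_Suc step_def Field_card_of)
  qed (simp add: C_def AB)
  then have card: "|\<Union>n\<in>UNIV. C n| \<le>o |B|"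
    using inf by (simp add: card_of_UNION_ordLeq_infinite infinite_iff_card_of_nat)
  have "mono C" by (rule mono_iff_le_Suc[THEN iffD2]) (auto simp: C_Suc step_def)
  have "closed_under c (\<Union>n\<in>UNIV. C n)"
    unfolding closed_under_def
  proof (intro allI impI, elim conjE)
    fix F assume F: "finite F" "F \<subseteq> (\<Union>n\<in>UNIV. C n)"
    have "\<exists>D\<in>range C. C m \<union> C n \<subseteq> D" for m n
      using monoD[OF \<open>mono C\<close>, of m "max m n"] monoD[OF \<open>mono C\<close>, of n "max m n"] by auto
    then obtain n where "F \<subseteq> C n"
      using finite_subset_directed_Union[of F "range C"] F by auto
    then have "c F \<subseteq> C (Suc n)" using F by (auto simp: C_Suc step_def)
    then show "c F \<subseteq> (\<Union>n\<in>UNIV. C n)" by blast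
  qed
  moreover have "A \<subseteq> (\<Union>n\<in>UNIV. C n)" using C_def[of 0] by auto
  ultimately have "closed_under c hull A \<subseteq> (\<Union>n\<in>UNIV. C n)" by (rule hull_minimal[rotated])
  then show ?thesis by (rule ordLeq_transitive[OF card_of_mono1 card])
qed

text \<open>
  The form needed along a chain of length \<open>|J|\<close>: hulls of proper initial segments of an uncountable
  set stay smaller than the set, also when the initial segment is finite or countable.
\<close>
lemma card_of_hull_ordLess:
  assumes unc: "uncountable J" and AJ: "|A| <o |J|"
    and c: "\<And>F. finite F \<Longrightarrow> countable (c F)"
  shows "|closed_under c hull A| <o |J|"
proof (cases "countable A")
  case True
  then have "countable (closed_under c hull A)"
    using card_of_hull_ordLeq[of "UNIV :: nat set" A c] c
    by (simp add: countable_iff_ordLeq_nat)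
  then have "\<not> |J| \<le>o |closed_under c hull A|"
    using unc ordLeq_transitive[of "|J|" "|closed_under c hull A|" "|UNIV :: nat set|"]
    by (auto simp: countable_iff_ordLeq_nat)
  then show ?thesis by (simp add: not_ordLeq_iff_ordLess[OF card_of_Well_order card_of_Well_order])
next
  case False
  then have "infinite A" using countable_finite by blast
  then have "|closed_under c hull A| \<le>o |A|"
    using card_of_hull_ordLeq[of A A c, OF _ ordIso_imp_ordLeq[OF card_of_refl]] c by blast
  then show ?thesis using AJ by (rule ordLeq_ordLess_trans)
qed

section \<open>Point-countable separating families\<close>

lemma Hausdorff_space_t2: "Hausdorff_space (euclidean :: 'a::t2_space topology)"
  unfolding Hausdorff_space_def disjnt_def by simp (metis hausdorff)

text \<open>
  Urysohn's lemma for a compact subset of a type that need not itself be normal.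
\<close>
lemma compact_Urysohn:
  fixes C :: "'a::t2_space set"
  assumes C: "compact C" and A: "closed A" "A \<subseteq> C" and B: "closed B" "B \<subseteq> C" and "A \<inter> B = {}"
  obtains g :: "'a \<Rightarrow> real" where "continuous_on C g" "\<And>x. x \<in> C \<Longrightarrow> 0 \<le> g x \<and> g x \<le> 1"
    "\<And>x. x \<in> A \<Longrightarrow> g x = 0" "\<And>x. x \<in> B \<Longrightarrow> g x = 1"
proof -
  have "normal_space (top_of_set C)"
    using C by (intro compact_Hausdorff_or_regular_imp_normal_space)
      (auto simp: compact_space_subtopology Hausdorff_space_subtopology Hausdorff_space_t2)
  moreover have "closedin (top_of_set C) A" "closedin (top_of_set C) B"
    using A B by (auto intro: closed_subset)
  ultimately obtain g where "continuous_map (top_of_set C) (top_of_set {0..1::real}) g"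
      "g ` A \<subseteq> {0}" "g ` B \<subseteq> {1}"
    using Urysohn_lemma[of "top_of_set C" A B 0 1] \<open>A \<inter> B = {}\<close>
    by (auto simp: disjnt_def)
  then show thesis by (intro that[of g]) (auto simp: continuous_map_in_subtopology)
qed

lemma Hausdorff_space_fun: "Hausdorff_space (euclidean :: ('i \<Rightarrow> real) topology)"
  using Hausdorff_space_product_topology[of "\<lambda>_. euclidean :: real topology" "UNIV :: 'i set"]
  by (simp add: euclidean_product_topology Hausdorff_space_euclidean)

lemma compact_imp_closed_fun:
  fixes S :: "('i \<Rightarrow> real) set"
  shows "compact S \<Longrightarrow> closed S"
  using compactin_imp_closedin[OF Hausdorff_space_fun, of S] by simp

text \<open>
  A set of continuous functions of which every point sees only countably many nonzero values. Taking
  the functions as coordinates, such a family is a continuous map into a \<open>\<Sigma>\<close>-product.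
  Families are sets of functions, not indexed families, so that families constructed in different
  ways can be united within one type.
\<close>
definition sigma_family :: "'a::topological_space set \<Rightarrow> ('a \<Rightarrow> real) set \<Rightarrow> bool" where
  "sigma_family X G \<longleftrightarrow>
     (\<forall>g\<in>G. continuous_on X g) \<and> (\<forall>x\<in>X. countable {g \<in> G. g x \<noteq> 0})"

definition separates :: "('a \<Rightarrow> real) set \<Rightarrow> 'a set \<Rightarrow> bool" where
  "separates G X \<longleftrightarrow> (\<forall>x\<in>X. \<forall>y\<in>X. (\<forall>g\<in>G. g x = g y) \<longrightarrow> x = y)"

text \<open>
  The coordinate functions of an embedding into a \<open>\<Sigma>\<close>-product form the required family.
\<close>
lemma Corson_compact_imp_sigma_family:
  fixes X :: "'a::t2_space set"
  assumes "Corson_compact (top_of_set X)"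
  shows "\<exists>G. sigma_family X G \<and> separates G X"
proof -
  obtain I :: "('a \<Rightarrow> real) set" and S h where S: "S \<subseteq> Sigma_product I"
    and h: "homeomorphic_map (top_of_set X) (subtopology (product_topology (\<lambda>_. euclideanreal) I) S) h"
    using assms unfolding Corson_compact_def Sigma_embeddable_def homeomorphic_space by blast
  have hcont: "continuous_map (top_of_set X) (product_topology (\<lambda>_. euclideanreal) I) h"
    using homeomorphic_imp_continuous_map[OF h] by (simp add: continuous_map_in_subtopology)
  have hinj: "inj_on h X" using homeomorphic_imp_injective_map[OF h] by simp
  have hS: "h x \<in> Sigma_product I" if "x \<in> X" for x
    using homeomorphic_imp_surjective_map[OF h] S that by auto
  define G where "G = (\<lambda>i x. h x i) ` I"
  have "sigma_family X G"
    unfolding sigma_family_def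
  proof (intro conjI ballI)
    fix g assume "g \<in> G"
    then show "continuous_on X g"
      using hcont by (auto simp: G_def continuous_map_componentwise)
  next
    fix x assume "x \<in> X"
    then have "countable {i \<in> I. h x i \<noteq> 0}" using hS by (auto simp: Sigma_product_def)
    moreover have "{g \<in> G. g x \<noteq> 0} \<subseteq> (\<lambda>i x. h x i) ` {i \<in> I. h x i \<noteq> 0}"
      by (auto simp: G_def)
    ultimately show "countable {g \<in> G. g x \<noteq> 0}" by (meson countable_image countable_subset)
  qed
  moreover have "separates G X"
    unfolding separates_def
  proof (intro ballI impI)
    fix x y assume xy: "x \<in> X" "y \<in> X" "\<forall>g\<in>G. g x = g y"
    then have "h x i = h y i" if "i \<in> I" for i using that by (auto simp: G_def)
    moreover have "h x \<in> extensional I" "h y \<in> extensional I"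
      using hS xy by (auto simp: Sigma_product_def PiE_def)
    ultimately have "h x = h y" by (metis extensionalityI)
    then show "x = y" using hinj xy by (auto dest: inj_onD)
  qed
  ultimately show ?thesis by blast
qed

text \<open>
  Conversely, the members of a separating family are the coordinates of an injective continuous map
  into a \<open>\<Sigma>\<close>-product, which is an embedding by compactness.
\<close>
lemma sigma_family_imp_Corson_compact:
  fixes X :: "'a::t2_space set"
  assumes X: "compact X" and G: "sigma_family X G" and sep: "separates G X"
  shows "Corson_compact (top_of_set X)"
proof (rule Corson_compactI)
  show "compact_space (top_of_set X)" using X by (simp add: compact_space_subtopology)
  let ?P = "product_topology (\<lambda>_. euclideanreal) G"
  define k where "k x = (\<lambda>g\<in>G. g x)" for x :: 'a
  have kcont: "continuous_map (top_of_set X) ?P k"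
    using G by (auto simp: continuous_map_componentwise k_def sigma_family_def)
  have kinj: "inj_on k X"
  proof (rule inj_onI)
    fix x y assume xy: "x \<in> X" "y \<in> X" "k x = k y"
    have "g x = g y" if "g \<in> G" for g
      using fun_cong[OF xy(3), of g] that by (simp add: k_def)
    then show "x = y" using sep xy by (auto simp: separates_def)
  qed
  have sub: "k ` X \<subseteq> Sigma_product G"
  proof clarify
    fix x assume "x \<in> X"
    moreover have "{g \<in> G. k x g \<noteq> 0} = {g \<in> G. g x \<noteq> 0}" by (auto simp: k_def)
    ultimately show "k x \<in> Sigma_product G"
      using G by (simp add: Sigma_product_def k_def sigma_family_def)
  qed
  have "topspace (subtopology ?P (k ` X)) = k ` X"
    using sub by (auto simp: Sigma_product_def)
  then have "homeomorphic_map (top_of_set X) (subtopology ?P (k ` X)) k"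
    using X kcont kinj
    by (intro continuous_imp_homeomorphic_map)
      (auto simp: continuous_map_in_subtopology Hausdorff_space_subtopology
        Hausdorff_space_product_topology compact_space_subtopology)
  then show "Sigma_embeddable G (top_of_set X)"
    using sub unfolding Sigma_embeddable_def homeomorphic_space by blast
qed

lemma sigma_family_subset: "sigma_family X G \<Longrightarrow> Y \<subseteq> X \<Longrightarrow> sigma_family Y G"
  unfolding sigma_family_def by (meson continuous_on_subset subset_iff)

lemma separates_subset: "separates G X \<Longrightarrow> Y \<subseteq> X \<Longrightarrow> separates G Y"
  unfolding separates_def by blast

section \<open>Rational boxes and restriction of coordinates\<close>

text \<open>
  Closed boxes have compact traces on compact sets, and boxes around a point are still found inside every open
  set around it. Rational bounds are used because then only countably many finite boxes refer to a
  given countable set of coordinates.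
\<close>
definition rational_box :: "('i \<times> rat \<times> rat) set \<Rightarrow> ('i \<Rightarrow> real) set" where
  "rational_box P = {y. \<forall>(i, a, b)\<in>P. of_rat a \<le> y i \<and> y i \<le> of_rat b}"

lemma closed_rational_box: "closed (rational_box P)"
proof -
  have "rational_box P = (\<Inter>(i, a, b)\<in>P. {y. of_rat a \<le> y i} \<inter> {y. y i \<le> of_rat b})"
    by (auto simp: rational_box_def)
  moreover have "closed {y :: 'i \<Rightarrow> real. c \<le> y i}" "closed {y :: 'i \<Rightarrow> real. y i \<le> c}" for i c
    by (auto intro!: closed_Collect_le)
  ultimately show ?thesis by (auto intro!: closed_INT closed_Int)
qed

text \<open>
  A basic open set restricts finitely many coordinates, and in each of them it contains a closed
  rational interval around the given value.
\<close>
lemma open_contains_rational_box: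
  fixes u :: "'i \<Rightarrow> real"
  assumes "open V" "u \<in> V"
  shows "\<exists>P. finite P \<and> u \<in> rational_box P \<and> rational_box P \<subseteq> V"
proof -
  obtain X where X: "u \<in> Pi\<^sub>E UNIV X" "\<And>i. open (X i)" "finite {i. X i \<noteq> UNIV}" "Pi\<^sub>E UNIV X \<subseteq> V"
    using product_topology_open_contains_basis[where T = "\<lambda>_. euclidean" and I = UNIV and U = V and x = u] assms
    by (auto simp: open_fun_def)
  have "\<exists>a b. of_rat a \<le> u i \<and> u i \<le> of_rat b \<and> {of_rat a..of_rat b} \<subseteq> X i" for i
  proof -
    obtain e where e: "e > 0" "\<And>t. \<bar>t - u i\<bar> < e \<Longrightarrow> t \<in> X i"
      using X(1) X(2)[of i] unfolding open_dist by (force simp: dist_real_def)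
    obtain a where "u i - e < of_rat a" "of_rat a < u i" using of_rat_dense[of "u i - e" "u i"] e by auto
    moreover obtain b where "u i < of_rat b" "of_rat b < u i + e" using of_rat_dense[of "u i" "u i + e"] e by auto
    ultimately show ?thesis using e(2) by (intro exI[of _ a] exI[of _ b]) auto
  qed
  then obtain a b where ab: "\<And>i. of_rat (a i) \<le> u i \<and> u i \<le> of_rat (b i) \<and> {of_rat (a i)..of_rat (b i)} \<subseteq> X i"
    by metis
  define P where "P = (\<lambda>i. (i, a i, b i)) ` {i. X i \<noteq> UNIV}"
  have "rational_box P \<subseteq> Pi\<^sub>E UNIV X"
  proof
    fix y assume y: "y \<in> rational_box P"
    have "y i \<in> X i" for i
    proof (cases "X i = UNIV")
      case False
      then have "y i \<in> {of_rat (a i)..of_rat (b i)}" using y by (auto simp: P_def rational_box_def)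
      then show ?thesis using ab[of i] by blast
    qed auto
    then show "y \<in> Pi\<^sub>E UNIV X" by auto
  qed
  then show ?thesis using X ab by (intro exI[of _ P]) (auto simp: P_def rational_box_def)
qed

definition restr :: "'i set \<Rightarrow> ('i \<Rightarrow> real) \<Rightarrow> ('i \<Rightarrow> real)" where
  "restr J y = (\<lambda>i. if i \<in> J then y i else 0)"

lemma restr_restr: "restr J (restr J' y) = restr (J \<inter> J') y"
  by (auto simp: restr_def)

lemma restr_supported: "{i. restr J y i \<noteq> 0} \<subseteq> J"
  by (auto simp: restr_def)

lemma continuous_on_restr: "continuous_on A (restr J)"
proof -
  have "continuous_on A (\<lambda>y. restr J y i)" for i
    by (cases "i \<in> J")
      (auto simp: restr_def intro: continuous_on_subset[OF continuous_on_product_coordinates])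
  then show ?thesis by (rule continuous_on_coordinatewise_then_product)
qed

text \<open>
  Among points supported in \<open>J\<close>, the conditions of a box on coordinates off \<open>J\<close> concern the value 0
  only, so they hold for all of these points as soon as they hold for one.
\<close>
lemma rational_box_supported:
  assumes "u \<in> rational_box P" "{i. u i \<noteq> 0} \<subseteq> J" "{i. z i \<noteq> 0} \<subseteq> J"
    and "z \<in> rational_box {p \<in> P. fst p \<in> J}"
  shows "z \<in> rational_box P"
  unfolding rational_box_def
proof clarify
  fix i a b assume iP: "(i, a, b) \<in> P"
  show "of_rat a \<le> z i \<and> z i \<le> of_rat b"
  proof (cases "i \<in> J")
    case True
    then have "(i, a, b) \<in> {p \<in> P. fst p \<in> J}" using iP by simp
    then show ?thesis using assms(4) unfolding rational_box_def by blast
  next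
    case False
    then have "z i = 0" "u i = 0" using assms(2,3) by blast+
    then have "z i = u i" by simp
    then show ?thesis using assms(1) iP unfolding rational_box_def by auto
  qed
qed

lemma countable_rational_conditions:
  "finite F \<Longrightarrow> countable {P :: ('i \<times> rat \<times> rat) set. finite P \<and> fst ` P \<subseteq> F}"
proof -
  assume "finite F"
  then have "countable (F \<times> (UNIV :: (rat \<times> rat) set))" by (simp add: countable_finite)
  then have "countable {P. finite P \<and> P \<subseteq> F \<times> (UNIV :: (rat \<times> rat) set)}"
    by (rule countable_Collect_finite_subset)
  then show ?thesis by (rule countable_subset[rotated]) auto
qed

text \<open>
  A continuous map from a compact space to a Hausdorff space is a quotient map onto its image.
\<close>
lemma continuous_on_quotient:
  fixes f :: "'a::topological_space \<Rightarrow> 'b::topological_space"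
  assumes T2: "Hausdorff_space (euclidean :: 'b topology)"
    and S: "compact S" and f: "continuous_on S f" and h: "continuous_on S (\<lambda>y. h (f y))"
  shows "continuous_on (f ` S) h"
proof -
  have "quotient_map (top_of_set S) (top_of_set (f ` S)) f"
    using S f by (intro continuous_imp_quotient_map)
      (auto simp: compact_space_subtopology Hausdorff_space_subtopology[OF T2]
        continuous_map_in_subtopology)
  then have "continuous_map (top_of_set (f ` S)) euclidean h"
    by (rule continuous_compose_quotient_map) (use h in \<open>simp add: o_def\<close>)
  then show ?thesis by simp
qed

section \<open>Restrictions compatible with a continuous map\<close>

text \<open>
  Exactly what is needed for \<open>restr J\<close> to induce a self-map of \<open>f ` S\<close>.
\<close>
definition compatible :: "('i \<Rightarrow> real) set \<Rightarrow> (('i \<Rightarrow> real) \<Rightarrow> 'k) \<Rightarrow> 'i set \<Rightarrow> bool" where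
  "compatible S f J \<longleftrightarrow> restr J ` S \<subseteq> S \<and>
     (\<forall>y\<in>S. \<forall>y'\<in>S. f y = f y' \<longrightarrow> f (restr J y) = f (restr J y'))"

lemma openin_preimage_box:
  fixes f :: "('i \<Rightarrow> real) \<Rightarrow> 'k::t2_space"
  assumes f: "continuous_on S f" and "open V" "u \<in> S" "f u \<in> V"
  shows "\<exists>P. finite P \<and> u \<in> rational_box P \<and> (\<forall>z\<in>S \<inter> rational_box P. f z \<in> V)"
proof -
  obtain W where W: "open W" "W \<inter> S = f -` V \<inter> S"
    using f \<open>open V\<close> unfolding continuous_on_open_invariant by metis
  then have "u \<in> W" using assms by auto
  then obtain P where "finite P" "u \<in> rational_box P" "rational_box P \<subseteq> W"
    using open_contains_rational_box[OF W(1)] by blast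
  then show ?thesis using W by (intro exI[of _ P]) auto
qed

text \<open>
  For any two boxes that contain points \<open>z, z' \<in> S\<close> with \<open>f z = f z'\<close>, choose one such pair and let
  the operation add its countable support to the coordinates that the boxes refer to. If \<open>J\<close> is
  closed and \<open>f y = f y'\<close>, then boxes around \<open>restr J y\<close> and \<open>restr J y'\<close>, cut down to their conditions
  on \<open>J\<close>, contain \<open>y\<close> and \<open>y'\<close>; hence the original boxes contain a chosen pair supported in \<open>J\<close>. So
  arbitrarily close to the two restrictions there are points of \<open>S\<close> with equal values under \<open>f\<close>.
  Since \<open>S\<close> is closed and \<open>f\<close> is continuous into a Hausdorff space, the restrictions lie in \<open>S\<close> and have
  equal values.
\<close>
lemma exists_compatibility_closure:
  fixes f :: "('i \<Rightarrow> real) \<Rightarrow> 'k::t2_space"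
  assumes S: "compact S" and supp: "\<And>y. y \<in> S \<Longrightarrow> countable {i. y i \<noteq> 0}"
    and f: "continuous_on S f"
  shows "\<exists>c. (\<forall>F. finite F \<longrightarrow> countable (c F)) \<and> (\<forall>J. closed_under c J \<longrightarrow> compatible S f J)"
proof -
  define twin where "twin P P' z z' \<longleftrightarrow> z \<in> S \<inter> rational_box P \<and> z' \<in> S \<inter> rational_box P' \<and> f z = f z'"
    for P P' z z'
  define w w' where "w P P' = fst (SOME q. twin P P' (fst q) (snd q))"
    and "w' P P' = snd (SOME q. twin P P' (fst q) (snd q))" for P P'
  have w: "twin P P' (w P P') (w' P P')" if "twin P P' z z'" for P P' z z'
    using someI[of "\<lambda>q. twin P P' (fst q) (snd q)" "(z, z')"] that by (simp add: w_def w'_def)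
  define W where "W P P' = (if \<exists>z z'. twin P P' z z' then {i. w P P' i \<noteq> 0} \<union> {i. w' P P' i \<noteq> 0} else {})"
    for P P'
  have "countable (W P P')" for P P'
    using w supp unfolding W_def twin_def by auto
  define \<P> where "\<P> F = {P :: ('i \<times> rat \<times> rat) set. finite P \<and> fst ` P \<subseteq> F}" for F
  define c where "c F = (\<Union>P\<in>\<P> F. \<Union>P'\<in>\<P> F. W P P')" for F
  have "countable (c F)" if "finite F" for F
    unfolding c_def \<P>_def
    using countable_rational_conditions[OF that] \<open>\<And>P P'. countable (W P P')\<close> by (intro countable_UN)
  moreover have "compatible S f J" if J: "closed_under c J" for J
  proof -
    have twins: "\<exists>z z'. z \<in> S \<inter> rational_box Q \<and> z' \<in> S \<inter> rational_box Q' \<and> f z = f z' \<and>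
          {i. z i \<noteq> 0} \<subseteq> J \<and> {i. z' i \<noteq> 0} \<subseteq> J"
      if y: "y \<in> S" "y' \<in> S" "f y = f y'" and Q: "finite Q" "restr J y \<in> rational_box Q"
        and Q': "finite Q'" "restr J y' \<in> rational_box Q'" for y y' Q Q'
    proof -
      define P P' where "P = {p \<in> Q. fst p \<in> J}" and "P' = {p \<in> Q'. fst p \<in> J}"
      have "y \<in> rational_box P" "y' \<in> rational_box P'"
        using Q Q' by (force simp: P_def P'_def rational_box_def restr_def)+
      then have t: "twin P P' y y'" using y by (simp add: twin_def)
      note tw = w[OF t]
      \<comment> \<open>One finite set of coordinates serves both boxes, as the operation takes a single argument.\<close>
      have "P \<in> \<P> (fst ` (P \<union> P'))" "P' \<in> \<P> (fst ` (P \<union> P'))"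
        using Q Q' by (auto simp: \<P>_def P_def P'_def)
      then have "W P P' \<subseteq> c (fst ` (P \<union> P'))" unfolding c_def by blast
      also have "\<dots> \<subseteq> J"
      proof -
        have "finite (fst ` (P \<union> P'))" "fst ` (P \<union> P') \<subseteq> J" using Q Q' by (auto simp: P_def P'_def)
        then show ?thesis using J unfolding closed_under_def by blast
      qed
      finally have "{i. w P P' i \<noteq> 0} \<subseteq> J" "{i. w' P P' i \<noteq> 0} \<subseteq> J"
        using t by (auto simp: W_def split: if_splits)
      then show ?thesis
        using tw rational_box_supported[OF Q(2) restr_supported, of "w P P'"]
          rational_box_supported[OF Q'(2) restr_supported, of "w' P P'"]
        by (intro exI[of _ "w P P'"] exI[of _ "w' P P'"]) (auto simp: twin_def P_def P'_def)
    qed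
    have inS: "restr J y \<in> S" if "y \<in> S" for y
    proof (rule ccontr)
      assume "restr J y \<notin> S"
      then obtain Q where "finite Q" "restr J y \<in> rational_box Q" "rational_box Q \<subseteq> - S"
        using open_contains_rational_box[of "- S" "restr J y"] compact_imp_closed_fun[OF S] by auto
      then show False using twins[OF that that refl, of Q Q] by blast
    qed
    moreover have "f (restr J y) = f (restr J y')" if y: "y \<in> S" "y' \<in> S" "f y = f y'" for y y'
    proof (rule ccontr)
      assume "f (restr J y) \<noteq> f (restr J y')"
      then obtain V V' where V: "open V" "open V'" "f (restr J y) \<in> V" "f (restr J y') \<in> V'" "V \<inter> V' = {}"
        by (metis hausdorff)
      obtain Q where Q: "finite Q" "restr J y \<in> rational_box Q" "\<forall>z\<in>S \<inter> rational_box Q. f z \<in> V"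
        using openin_preimage_box[OF f V(1) inS[OF y(1)] V(3)] by blast
      obtain Q' where Q': "finite Q'" "restr J y' \<in> rational_box Q'" "\<forall>z\<in>S \<inter> rational_box Q'. f z \<in> V'"
        using openin_preimage_box[OF f V(2) inS[OF y(2)] V(4)] by blast
      show False using twins[OF y Q(1,2) Q'(1,2)] Q(3) Q'(3) V(5) by (metis disjoint_iff)
    qed
    ultimately show ?thesis unfolding compatible_def by blast
  qed
  ultimately show ?thesis by blast
qed

text \<open>
  The self-map of \<open>f ` S\<close> induced by \<open>restr J\<close>. For \<open>J\<close> compatible with \<open>f\<close>,
  its value does not depend on the point chosen in the fibre.
\<close>
definition induced_map :: "('i \<Rightarrow> real) set \<Rightarrow> (('i \<Rightarrow> real) \<Rightarrow> 'k) \<Rightarrow> 'i set \<Rightarrow> 'k \<Rightarrow> 'k" where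
  "induced_map S f J x = f (restr J (SOME y. y \<in> S \<and> f y = x))"

lemma induced_map_apply:
  assumes "compatible S f J" "y \<in> S"
  shows "induced_map S f J (f y) = f (restr J y)"
proof -
  have "(SOME y'. y' \<in> S \<and> f y' = f y) \<in> S \<and> f (SOME y'. y' \<in> S \<and> f y' = f y) = f y"
    by (rule someI[of _ y]) (use assms in simp)
  then show ?thesis using assms unfolding compatible_def induced_map_def by blast
qed

lemma induced_map_in:
  assumes "compatible S f J" "x \<in> f ` S"
  shows "induced_map S f J x \<in> f ` S"
proof -
  obtain y where y: "y \<in> S" "x = f y" using assms by blast
  then have "restr J y \<in> S" using assms(1) by (auto simp: compatible_def)
  then show ?thesis using induced_map_apply[OF assms(1) y(1)] y(2) by simp
qed

lemma continuous_on_induced_map: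
  fixes f :: "('i \<Rightarrow> real) \<Rightarrow> 'k::t2_space"
  assumes "compact S" "continuous_on S f" "compatible S f J"
  shows "continuous_on (f ` S) (induced_map S f J)"
proof (rule continuous_on_quotient[OF Hausdorff_space_t2 assms(1,2)])
  have "continuous_on S (\<lambda>y. f (restr J y))"
    using assms by (intro continuous_on_compose2[OF assms(2) continuous_on_restr]) (auto simp: compatible_def)
  then show "continuous_on S (\<lambda>y. induced_map S f J (f y))"
    by (rule continuous_on_eq) (simp add: induced_map_apply[OF assms(3)])
qed

text \<open>
  The restrictions to the members of a directed family converge to the restriction to the union,
  because a box restricts finitely many coordinates. This is the limit step of the transfinite
  induction along a chain of coordinate sets.
\<close>
lemma restr_Union_eq_if:
  fixes f :: "('i \<Rightarrow> real) \<Rightarrow> 'k::t2_space"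
  assumes f: "continuous_on S f" and ne: "\<C> \<noteq> {}"
    and dir: "\<And>A B. A \<in> \<C> \<Longrightarrow> B \<in> \<C> \<Longrightarrow> \<exists>C\<in>\<C>. A \<union> B \<subseteq> C"
    and comp: "compatible S f (\<Union>\<C>)" "\<And>C. C \<in> \<C> \<Longrightarrow> compatible S f C"
    and y: "y \<in> S" "y' \<in> S" and eq: "\<And>C. C \<in> \<C> \<Longrightarrow> f (restr C y) = f (restr C y')"
  shows "f (restr (\<Union>\<C>) y) = f (restr (\<Union>\<C>) y')"
proof (rule ccontr)
  have near: "\<exists>C\<in>\<C>. \<forall>D\<in>\<C>. C \<subseteq> D \<longrightarrow> f (restr D u) \<in> V"
    if u: "u \<in> S" and V: "open V" "f (restr (\<Union>\<C>) u) \<in> V" for u V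
  proof -
    have "restr (\<Union>\<C>) u \<in> S" using comp(1) u by (auto simp: compatible_def)
    then obtain P where P: "finite P" "restr (\<Union>\<C>) u \<in> rational_box P" "\<forall>z\<in>S \<inter> rational_box P. f z \<in> V"
      using openin_preimage_box[OF f V(1) _ V(2)] by blast
    have "finite (fst ` P \<inter> \<Union>\<C>)" using P(1) by simp
    then have "\<exists>C\<in>\<C>. fst ` P \<inter> \<Union>\<C> \<subseteq> C"
      by (rule finite_subset_directed_Union[OF _ Int_lower2 ne dir])
    then obtain C where C: "C \<in> \<C>" "fst ` P \<inter> \<Union>\<C> \<subseteq> C" by blast
    have "f (restr D u) \<in> V" if D: "D \<in> \<C>" "C \<subseteq> D" for D
    proof -
      have "restr D u i = restr (\<Union>\<C>) u i" if "i \<in> fst ` P" for i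
        using that C D by (auto simp: restr_def)
      then have "restr D u \<in> rational_box P"
        using P(2) unfolding rational_box_def by force
      moreover have "restr D u \<in> S" using comp(2)[OF D(1)] u by (auto simp: compatible_def)
      ultimately show ?thesis using P(3) by blast
    qed
    then show ?thesis using C(1) by blast
  qed
  assume "f (restr (\<Union>\<C>) y) \<noteq> f (restr (\<Union>\<C>) y')"
  then obtain V V' where V: "open V" "open V'" "f (restr (\<Union>\<C>) y) \<in> V" "f (restr (\<Union>\<C>) y') \<in> V'" "V \<inter> V' = {}"
    by (metis hausdorff)
  obtain C where C: "C \<in> \<C>" "\<forall>D\<in>\<C>. C \<subseteq> D \<longrightarrow> f (restr D y) \<in> V" using near[OF y(1) V(1,3)] by blast
  obtain C' where C': "C' \<in> \<C>" "\<forall>D\<in>\<C>. C' \<subseteq> D \<longrightarrow> f (restr D y') \<in> V'" using near[OF y(2) V(2,4)] by blast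
  obtain D where "D \<in> \<C>" "C \<subseteq> D" "C' \<subseteq> D" using dir[OF C(1) C'(1)] by blast
  then have "f (restr D y) \<in> V" "f (restr D y) \<in> V'" using C C' eq by auto
  then show False using V(5) by blast
qed

section \<open>Continuous images of Corson compacta\<close>

text \<open>
  The points of \<open>S\<close> supported in a countable \<open>J\<close> have a countable network of compact boxes. A Urysohn
  function for each pair of boxes with disjoint images yields a countable separating family.
\<close>
lemma countable_support_sigma_family:
  fixes f :: "('i \<Rightarrow> real) \<Rightarrow> 'k::t2_space"
  assumes S: "compact S" and f: "continuous_on S f" and J: "countable J"
  shows "\<exists>G. sigma_family (f ` S) G \<and> separates G (f ` {y \<in> S. restr J y = y})"
proof -
  define D where "D P = {y \<in> S. restr J y = y} \<inter> rational_box P" for P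
  have SJ: "{y \<in> S. restr J y = y} = S \<inter> (\<Inter>i\<in>-J. {y. y i = 0})"
    by (auto simp: restr_def fun_eq_iff)
  have "closed (\<Inter>i\<in>-J. {y. y i = (0::real)})"
    by (intro closed_INT ballI closed_Collect_eq continuous_intros) auto
  then have "compact (D P)" for P
    unfolding D_def SJ using S by (intro compact_Int_closed closed_rational_box)
  then have fD: "compact (f ` D P)" for P
    using f by (intro compact_continuous_image) (auto simp: D_def intro: continuous_on_subset)
  define \<P> where "\<P> = {P :: ('i \<times> rat \<times> rat) set. finite P \<and> P \<subseteq> J \<times> UNIV}"
  have "countable (J \<times> (UNIV :: (rat \<times> rat) set))" using J by simp
  then have "countable \<P>" unfolding \<P>_def by (rule countable_Collect_finite_subset)
  define Q where "Q = {(P, P'). P \<in> \<P> \<and> P' \<in> \<P> \<and> f ` D P \<inter> f ` D P' = {}}"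
  have "Q \<subseteq> \<P> \<times> \<P>" by (auto simp: Q_def)
  then have "countable Q" using \<open>countable \<P>\<close> by (meson countable_SIGMA countable_subset)
  have "\<exists>g. continuous_on (f ` S) g \<and> (\<forall>x\<in>f ` D P. g x = 0) \<and> (\<forall>x\<in>f ` D P'. g x = (1::real))"
    if dis: "f ` D P \<inter> f ` D P' = {}" for P P'
  proof -
    have "compact (f ` S)" using S f by (intro compact_continuous_image)
    moreover have "f ` D R \<subseteq> f ` S" for R by (auto simp: D_def)
    ultimately obtain g :: "'k \<Rightarrow> real" where "continuous_on (f ` S) g"
      "\<And>x. x \<in> f ` D P \<Longrightarrow> g x = 0" "\<And>x. x \<in> f ` D P' \<Longrightarrow> g x = 1"
      using compact_Urysohn[OF _ compact_imp_closed[OF fD] _ compact_imp_closed[OF fD] _ dis] by metis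
    then show ?thesis by blast
  qed
  then obtain g where g: "\<And>P P'. f ` D P \<inter> f ` D P' = {} \<Longrightarrow> continuous_on (f ` S) (g P P') \<and>
      (\<forall>x\<in>f ` D P. g P P' x = 0) \<and> (\<forall>x\<in>f ` D P'. g P P' x = (1::real))"
    by metis
  define G where "G = (\<lambda>(P, P'). g P P') ` Q"
  have "countable G" using \<open>countable Q\<close> by (simp add: G_def)
  then have "sigma_family (f ` S) G"
    using g unfolding sigma_family_def by (auto simp: G_def Q_def)
  moreover have "separates G (f ` {y \<in> S. restr J y = y})"
    unfolding separates_def
  proof (intro ballI impI, rule ccontr)
    fix x x' assume x: "x \<in> f ` {y \<in> S. restr J y = y}" "x' \<in> f ` {y \<in> S. restr J y = y}"
      and eq: "\<forall>g\<in>G. g x = g x'" and "x \<noteq> x'"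
    then obtain V V' where V: "open V" "open V'" "x \<in> V" "x' \<in> V'" "V \<inter> V' = {}"
      by (metis hausdorff)
    have box: "\<exists>P\<in>\<P>. z \<in> f ` D P \<and> f ` D P \<subseteq> W"
      if z: "z \<in> f ` {y \<in> S. restr J y = y}" and W: "open W" "z \<in> W" for z W
    proof -
      obtain u where u: "u \<in> S" "restr J u = u" "z = f u" using z by blast
      obtain P where P: "finite P" "u \<in> rational_box P" "\<forall>v\<in>S \<inter> rational_box P. f v \<in> W"
        using openin_preimage_box[OF f W(1) u(1)] W u by blast
      define P' where "P' = {p \<in> P. fst p \<in> J}"
      have supp: "{i. v i \<noteq> 0} \<subseteq> J" if "restr J v = v" for v
        using restr_supported[of J v] that by simp
      have "P' \<in> \<P>" using P(1) by (auto simp: P'_def \<P>_def)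
      moreover have "u \<in> D P'" using P(2) u by (auto simp: D_def P'_def rational_box_def)
      moreover have "f v \<in> W" if v: "v \<in> D P'" for v
      proof -
        have "v \<in> rational_box P"
          by (rule rational_box_supported[OF P(2) supp[OF u(2)] supp]) (use v in \<open>auto simp: D_def P'_def\<close>)
        then show ?thesis using P(3) v by (auto simp: D_def)
      qed
      ultimately show ?thesis using u(3) by blast
    qed
    obtain P where P: "P \<in> \<P>" "x \<in> f ` D P" "f ` D P \<subseteq> V" using box[OF x(1) V(1,3)] by blast
    obtain P' where P': "P' \<in> \<P>" "x' \<in> f ` D P'" "f ` D P' \<subseteq> V'" using box[OF x(2) V(2,4)] by blast
    have dis: "f ` D P \<inter> f ` D P' = {}" using P P' V(5) by blast
    then have "(P, P') \<in> Q" using P P' by (simp add: Q_def)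
    then have "g P P' \<in> G" by (force simp: G_def)
    then have "g P P' x = g P P' x'" using eq by blast
    then show False using g[OF dis] P(2) P'(2) by simp
  qed
  ultimately show ?thesis by blast
qed

text \<open>
  Applying \<open>g\<close> at both ends of a step of a chain of retractions makes the function vanish wherever
  the step does not move the point, so that only the countably many active steps contribute.
\<close>
lemma sigma_family_chain:
  fixes K :: "'k::t2_space set"
  assumes G: "\<And>a. a \<in> J \<Longrightarrow> sigma_family K (G a)"
    and p: "\<And>a. a \<in> J \<Longrightarrow> continuous_on K (p a)" "\<And>a. a \<in> J \<Longrightarrow> p a ` K \<subseteq> K"
    and q: "\<And>a. a \<in> J \<Longrightarrow> continuous_on K (q a)" "\<And>a. a \<in> J \<Longrightarrow> q a ` K \<subseteq> K"
    and few: "\<And>x. x \<in> K \<Longrightarrow> countable {a \<in> J. p a x \<noteq> q a x}"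
  shows "sigma_family K (\<Union>a\<in>J. (\<lambda>g x. g (p a x) - g (q a x)) ` G a)"
  unfolding sigma_family_def
proof (intro conjI ballI)
  fix h assume "h \<in> (\<Union>a\<in>J. (\<lambda>g x. g (p a x) - g (q a x)) ` G a)"
  then obtain a g where a: "a \<in> J" and g: "g \<in> G a" and h: "h = (\<lambda>x. g (p a x) - g (q a x))" by blast
  have "continuous_on K g" using G[OF a] g by (simp add: sigma_family_def)
  then show "continuous_on K h"
    unfolding h using p[OF a] q[OF a]
    by (intro continuous_on_diff) (blast intro: continuous_on_compose2)+
next
  fix x assume x: "x \<in> K"
  let ?N = "\<lambda>a. {g \<in> G a. g (p a x) \<noteq> 0} \<union> {g \<in> G a. g (q a x) \<noteq> 0}"
  have "countable (?N a)" if a: "a \<in> J" for a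
    using G[OF a] p(2)[OF a] q(2)[OF a] x unfolding sigma_family_def by (auto simp: image_subset_iff)
  then have "countable (\<Union>a\<in>{a \<in> J. p a x \<noteq> q a x}. (\<lambda>g x. g (p a x) - g (q a x)) ` ?N a)"
    using few[OF x] by (intro countable_UN countable_image) auto
  moreover have "{h \<in> (\<Union>a\<in>J. (\<lambda>g x. g (p a x) - g (q a x)) ` G a). h x \<noteq> 0}
      \<subseteq> (\<Union>a\<in>{a \<in> J. p a x \<noteq> q a x}. (\<lambda>g x. g (p a x) - g (q a x)) ` ?N a)"
  proof clarify
    fix a g assume a: "a \<in> J" "g \<in> G a" "g (p a x) - g (q a x) \<noteq> 0"
    then have "p a x \<noteq> q a x" "g \<in> ?N a" by auto
    then show "(\<lambda>x. g (p a x) - g (q a x)) \<in> (\<Union>a\<in>{a \<in> J. p a x \<noteq> q a x}. (\<lambda>g x. g (p a x) - g (q a x)) ` ?N a)"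
      using a(1) by blast
  qed
  ultimately show "countable {h \<in> (\<Union>a\<in>J. (\<lambda>g x. g (p a x) - g (q a x)) ` G a). h x \<noteq> 0}"
    by (rule countable_subset[rotated])
qed

lemma sigma_family_compose:
  fixes K :: "'k::t2_space set"
  assumes G: "sigma_family K G" and p: "continuous_on K p" "p ` K \<subseteq> K"
  shows "sigma_family K ((\<lambda>g x. g (p x)) ` G)"
  unfolding sigma_family_def
proof (intro conjI ballI)
  fix h assume "h \<in> (\<lambda>g x. g (p x)) ` G"
  then show "continuous_on K h"
    using G p by (auto simp: sigma_family_def intro: continuous_on_compose2)
next
  fix x assume "x \<in> K"
  then have "countable {g \<in> G. g (p x) \<noteq> 0}" using G p unfolding sigma_family_def by blast
  moreover have "{h \<in> (\<lambda>g x. g (p x)) ` G. h x \<noteq> 0} \<subseteq> (\<lambda>g x. g (p x)) ` {g \<in> G. g (p x) \<noteq> 0}" by auto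
  ultimately show "countable {h \<in> (\<lambda>g x. g (p x)) ` G. h x \<noteq> 0}"
    by (meson countable_image countable_subset)
qed

lemma sigma_family_Un: "sigma_family K G \<Longrightarrow> sigma_family K H \<Longrightarrow> sigma_family K (G \<union> H)"
proof -
  assume GH: "sigma_family K G" "sigma_family K H"
  have "{g \<in> G \<union> H. g x \<noteq> 0} = {g \<in> G. g x \<noteq> 0} \<union> {g \<in> H. g x \<noteq> 0}" for x by auto
  then show ?thesis using GH by (auto simp: sigma_family_def)
qed

text \<open>
  Well-order \<open>J\<close> in its initial order type and let \<open>J\<^sub>a\<close> and \<open>J\<^sub>a\<^sup>+\<close> be the closures of the initial segments
  below \<open>a\<close>, without and with \<open>a\<close>. These have smaller cardinality than \<open>J\<close>, and a coordinate enters
  the chain at one stage \<open>a\<close> only; so a point of countable support has \<open>restr J\<^sub>a\<^sup>+ y \<noteq> restr J\<^sub>a y\<close>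
  for countably many \<open>a\<close>. If all functions of the resulting family agree at two points, then their
  images under the retractions agree at all stages by transfinite induction: up to \<open>J\<^sub>a\<close> by the
  limit step, and from \<open>J\<^sub>a\<close> to \<open>J\<^sub>a\<^sup>+\<close> because the values \<open>g(s\<^sub>a\<^sup>+ x) - g(s\<^sub>a x)\<close> agree and the second terms
  agree already.
\<close>
lemma image_sigma_family_step:
  fixes f :: "('i \<Rightarrow> real) \<Rightarrow> 'k::t2_space"
  assumes S: "compact S" and supp: "\<And>y. y \<in> S \<Longrightarrow> countable {i. y i \<noteq> 0}"
    and f: "continuous_on S f"
    and c: "\<And>F. finite F \<Longrightarrow> countable (c F)" "\<And>J. closed_under c J \<Longrightarrow> compatible S f J"
    and J: "closed_under c J" "uncountable J"
    and IH: "\<And>J'. closed_under c J' \<Longrightarrow> |J'| <o |J| \<Longrightarrow>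
        \<exists>G. sigma_family (f ` S) G \<and> separates G (f ` {y \<in> S. restr J' y = y})"
  shows "\<exists>G. sigma_family (f ` S) G \<and> separates G (f ` {y \<in> S. restr J y = y})"
proof -
  define r where "r = |J|"
  have "Card_order r" unfolding r_def by (rule card_of_Card_order)
  have "Field r = J" by (simp add: r_def Field_card_of)
  have "Well_order r" by (simp add: r_def card_of_Well_order)
  then have wo: "wo_rel r" by (simp add: wo_rel_def)
  have refl: "Refl r" and trans: "trans r" and antisym: "antisym r"
    using \<open>Well_order r\<close> by (auto simp: order_on_defs)
  let ?H = "\<lambda>A. closed_under c hull A"
  have H_closed: "closed_under c (?H A)" for A by (rule closed_under_hull)
  have H_mono: "A \<subseteq> B \<Longrightarrow> ?H A \<subseteq> ?H B" for A B by (rule hull_mono)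
  have under_J: "under r a \<subseteq> J" "underS r a \<subseteq> J" for a
    using \<open>Field r = J\<close> by (auto simp: under_def underS_def Field_def)
  have under_eq: "under r a = insert a (underS r a)" if "a \<in> J" for a
    using Refl_under_underS[OF refl] that \<open>Field r = J\<close> by simp
  have inf: "infinite J" using J(2) countable_finite by blast
  have small_S: "|underS r a| <o |J|" if "a \<in> J" for a
    using card_of_underS[OF \<open>Card_order r\<close>] that \<open>Field r = J\<close> by (simp add: r_def)
  have fin_small: "|{a}| <o |J|" for a
    by (rule finite_ordLess_infinite_set) (use inf in auto)
  have small: "|under r a| <o |J|" if a: "a \<in> J" for a
  proof -
    have "|{a} \<union> underS r a| <o |J|"
      by (rule card_of_Un_ordLess_infinite[OF inf fin_small small_S[OF a]])
    then show ?thesis by (simp add: under_eq[OF a])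
  qed
  define p where "p a = induced_map S f (?H (under r a))" for a
  define q where "q a = induced_map S f (?H (underS r a))" for a
  define p0 where "p0 = induced_map S f (?H {})"
  have comp: "compatible S f (?H A)" for A by (rule c(2)[OF H_closed])
  have cont: "continuous_on (f ` S) (induced_map S f (?H A))" for A
    by (rule continuous_on_induced_map[OF S f comp])
  have into: "induced_map S f (?H A) ` (f ` S) \<subseteq> f ` S" for A
    using induced_map_in[OF comp] by blast
  have hull_small: "|?H A| <o |J|" if "|A| <o |J|" for A
    using J(2) that c(1) by (rule card_of_hull_ordLess)
  have "\<forall>a\<in>J. \<exists>G. sigma_family (f ` S) G \<and> separates G (f ` {y \<in> S. restr (?H (under r a)) y = y})"
    using IH[OF H_closed hull_small[OF small]] by blast
  from bchoice[OF this] obtain G where G: "\<And>a. a \<in> J \<Longrightarrow> sigma_family (f ` S) (G a)"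
      "\<And>a. a \<in> J \<Longrightarrow> separates (G a) (f ` {y \<in> S. restr (?H (under r a)) y = y})"
    by auto
  have "|{}::'i set| <o |J|" by (rule finite_ordLess_infinite_set) (use inf in auto)
  from IH[OF H_closed hull_small[OF this]]
  obtain G0 where G0: "sigma_family (f ` S) G0" "separates G0 (f ` {y \<in> S. restr (?H {}) y = y})"
    by blast
  have few: "countable {a \<in> J. p a x \<noteq> q a x}" if x: "x \<in> f ` S" for x
  proof -
    obtain y where y: "y \<in> S" "x = f y" using x by blast
    define B where "B i = {a \<in> J. i \<in> ?H (under r a) - ?H (underS r a)}" for i
    have unique: "a = b" if "a \<in> B i" "b \<in> B i" for a b i
    proof (rule ccontr)
      have below: "False" if "a \<in> B i" "b \<in> B i" "(a, b) \<in> r" "a \<noteq> b" for a b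
      proof -
        have "under r a \<subseteq> underS r b"
          using that trans antisym unfolding under_def underS_def trans_def antisym_def by blast
        then have "?H (under r a) \<subseteq> ?H (underS r b)" by (rule H_mono)
        then show False using that by (auto simp: B_def)
      qed
      assume "a \<noteq> b"
      moreover have "(a, b) \<in> r \<or> (b, a) \<in> r"
        using wo_rel.TOTALS[OF wo] that \<open>Field r = J\<close> by (auto simp: B_def)
      ultimately show False using below that by metis
    qed
    have "countable (B i)" for i
    proof (cases "B i = {}")
      case False
      then obtain a where "a \<in> B i" by blast
      then have "B i \<subseteq> {a}" using unique by blast
      then show ?thesis by (rule countable_subset) simp
    qed simp
    then have "countable (\<Union>i\<in>{i. y i \<noteq> 0}. B i)" using supp[OF y(1)] by blast
    moreover have "{a \<in> J. p a x \<noteq> q a x} \<subseteq> (\<Union>i\<in>{i. y i \<noteq> 0}. B i)"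
    proof clarify
      fix a assume a: "a \<in> J" "p a x \<noteq> q a x"
      then have "restr (?H (under r a)) y \<noteq> restr (?H (underS r a)) y"
        unfolding p_def q_def y(2) induced_map_apply[OF comp y(1)] by metis
      then obtain i where "restr (?H (under r a)) y i \<noteq> restr (?H (underS r a)) y i" by blast
      moreover have "?H (underS r a) \<subseteq> ?H (under r a)" by (rule H_mono[OF underS_subset_under])
      ultimately have "y i \<noteq> 0" "i \<in> ?H (under r a) - ?H (underS r a)"
        by (auto simp: restr_def split: if_splits)
      then show "a \<in> (\<Union>i\<in>{i. y i \<noteq> 0}. B i)" using a(1) by (auto simp: B_def)
    qed
    ultimately show ?thesis by (rule countable_subset[rotated])
  qed
  define G' where "G' = (\<lambda>g x. g (p0 x)) ` G0 \<union> (\<Union>a\<in>J. (\<lambda>g x. g (p a x) - g (q a x)) ` G a)"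
  have "sigma_family (f ` S) G'"
    unfolding G'_def
    using sigma_family_Un[OF sigma_family_compose[OF G0(1)] sigma_family_chain[where G = G and p = p and q = q and J = J]]
      G(1) few cont into by (simp add: p_def q_def p0_def)
  moreover have "separates G' (f ` {y \<in> S. restr J y = y})"
    unfolding separates_def
  proof clarify
    fix y y' assume y: "y \<in> S" "restr J y = y" "y' \<in> S" "restr J y' = y'" and eq: "\<forall>g\<in>G'. g (f y) = g (f y')"
    have sep: "f (restr (?H A) y) = f (restr (?H A) y')"
      if "separates E (f ` {y \<in> S. restr (?H A) y = y})"
        "\<And>g. g \<in> E \<Longrightarrow> g (f (restr (?H A) y)) = g (f (restr (?H A) y'))" for E A
    proof -
      have "restr (?H A) y \<in> S" "restr (?H A) y' \<in> S" using comp y by (auto simp: compatible_def)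
      then have "f (restr (?H A) y) \<in> f ` {y \<in> S. restr (?H A) y = y}"
        "f (restr (?H A) y') \<in> f ` {y \<in> S. restr (?H A) y = y}" by (auto simp: restr_restr)
      then show ?thesis using that unfolding separates_def by blast
    qed
    have base: "f (restr (?H {}) y) = f (restr (?H {}) y')"
    proof (rule sep[OF G0(2)])
      fix g assume "g \<in> G0"
      then have "(\<lambda>x. g (p0 x)) \<in> G'" by (auto simp: G'_def)
      from bspec[OF eq this] have "g (p0 (f y)) = g (p0 (f y'))" by simp
      then show "g (f (restr (?H {}) y)) = g (f (restr (?H {}) y'))"
        using y by (simp add: p0_def induced_map_apply[OF comp])
    qed
    \<comment> \<open>Used for the segments below a stage and, at the end, for all of \<open>J\<close>.\<close>
    have chain: "f (restr (?H B) y) = f (restr (?H B) y')"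
      if B: "B \<subseteq> J" "\<And>b. b \<in> B \<Longrightarrow> under r b \<subseteq> B"
        and eqB: "\<And>b. b \<in> B \<Longrightarrow> f (restr (?H (under r b)) y) = f (restr (?H (under r b)) y')" for B
    proof -
      \<comment> \<open>The hull of the empty set keeps the family nonempty when \<open>B\<close> is an empty segment.\<close>
      define \<C> where "\<C> = insert (?H {}) ((\<lambda>b. ?H (under r b)) ` B)"
      have ne: "\<C> \<noteq> {}" by (simp add: \<C>_def)
      have C_mono: "?H (under r a) \<subseteq> ?H (under r b) \<or> ?H (under r b) \<subseteq> ?H (under r a)"
        if "a \<in> B" "b \<in> B" for a b
      proof -
        have "(a, b) \<in> r \<or> (b, a) \<in> r"
          using wo_rel.TOTALS[OF wo] that B(1) \<open>Field r = J\<close> by blast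
        then have "under r a \<subseteq> under r b \<or> under r b \<subseteq> under r a"
          using under_incr[OF trans] by blast
        then show ?thesis using H_mono by blast
      qed
      have C_dir: "\<exists>C\<in>\<C>. X \<union> Y \<subseteq> C" if "X \<in> \<C>" "Y \<in> \<C>" for X Y
      proof -
        have least: "?H {} \<subseteq> C" if "C \<in> \<C>" for C
          using that H_mono[OF empty_subsetI] by (auto simp: \<C>_def)
        have "X \<subseteq> Y \<or> Y \<subseteq> X"
        proof (cases "X = ?H {} \<or> Y = ?H {}")
          case True
          then show ?thesis using least that by blast
        next
          case False
          then show ?thesis using that C_mono by (auto simp: \<C>_def)
        qed
        then show ?thesis using that by (metis sup.absorb1 sup.absorb2 order_refl)
      qed
      have C_closed: "closed_under c C" if "C \<in> \<C>" for C using that H_closed by (auto simp: \<C>_def)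
      have U_closed: "closed_under c (\<Union>\<C>)" by (rule closed_under_directed_Union[OF ne C_dir C_closed])
      have "B \<subseteq> \<Union>\<C>"
      proof
        fix b assume b: "b \<in> B"
        then have "b \<in> under r b" using under_eq B(1) by blast
        then show "b \<in> \<Union>\<C>" using b hull_inc[of b "under r b" "closed_under c"] by (auto simp: \<C>_def)
      qed
      then have "?H B \<subseteq> \<Union>\<C>" using U_closed by (rule hull_minimal)
      moreover have "\<Union>\<C> \<subseteq> ?H B"
        using H_mono[OF B(2)] H_mono[OF empty_subsetI, of B] by (auto simp only: \<C>_def)
      ultimately have HB: "?H B = \<Union>\<C>" by (rule equalityI)
      show ?thesis
        unfolding HB
        by (rule restr_Union_eq_if[OF f ne C_dir c(2)[OF U_closed] c(2)[OF C_closed] y(1,3)])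
          (use base eqB in \<open>auto simp: \<C>_def\<close>)
    qed
    have all: "a \<in> J \<longrightarrow> f (restr (?H (under r a)) y) = f (restr (?H (under r a)) y')" for a
    proof (induction a rule: wo_rel.well_order_induct[OF wo])
      case (1 a)
      show ?case
      proof (intro impI sep[OF G(2)])
        fix g assume a: "a \<in> J" and g: "g \<in> G a"
        have "(\<lambda>x. g (p a x) - g (q a x)) \<in> G'" using a g by (auto simp: G'_def)
        from bspec[OF eq this] have "g (p a (f y)) - g (q a (f y)) = g (p a (f y')) - g (q a (f y'))"
          by simp
        moreover have "f (restr (?H (underS r a)) y) = f (restr (?H (underS r a)) y')"
        proof (rule chain[OF under_J(2)])
          fix b assume b: "b \<in> underS r a"
          show "under r b \<subseteq> underS r a"
            using b trans antisym unfolding under_def underS_def trans_def antisym_def by blast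
          show "f (restr (?H (under r b)) y) = f (restr (?H (under r b)) y')"
            using 1 b under_J(2) by (auto simp: underS_def)
        qed
        ultimately show "g (f (restr (?H (under r a)) y)) = g (f (restr (?H (under r a)) y'))"
          using y by (simp add: p_def q_def induced_map_apply[OF comp])
      qed
    qed
    have "f (restr (?H J) y) = f (restr (?H J) y')" by (rule chain) (use all under_J in auto)
    then show "f y = f y'" using y J(1) by (simp add: hull_same)
  qed
  ultimately show ?thesis by blast
qed

text \<open>
  Well-founded induction on the cardinality of a closed set of coordinates; the set of all
  coordinates is closed.
\<close>
theorem image_sigma_family:
  fixes f :: "('i \<Rightarrow> real) \<Rightarrow> 'k::t2_space"
  assumes S: "compact S" and supp: "\<And>y. y \<in> S \<Longrightarrow> countable {i. y i \<noteq> 0}"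
    and f: "continuous_on S f"
  shows "\<exists>G. sigma_family (f ` S) G \<and> separates G (f ` S)"
proof -
  obtain c where c: "\<And>F. finite F \<Longrightarrow> countable (c F)" "\<And>J. closed_under c J \<Longrightarrow> compatible S f J"
    using exists_compatibility_closure[OF S supp f] by blast
  have "closed_under c J \<longrightarrow> (\<exists>G. sigma_family (f ` S) G \<and> separates G (f ` {y \<in> S. restr J y = y}))" for J
  proof (induction J rule: wf_induct_rule[OF wf_inv_image[OF wf_ordLess, of card_of]])
    case (1 J)
    show ?case
    proof (cases "countable J")
      case True
      then show ?thesis using countable_support_sigma_family[OF S f] by blast
    next
      case False
      show ?thesis
      proof
        assume "closed_under c J"
        then show "\<exists>G. sigma_family (f ` S) G \<and> separates G (f ` {y \<in> S. restr J y = y})"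
          using image_sigma_family_step[where S = S and f = f and c = c and J = J]
            S supp f c False 1 by (simp add: inv_image_def)
      qed
    qed
  qed
  from this[of UNIV] show ?thesis by (simp add: closed_under_def restr_def)
qed

text \<open>
  Continuous images of Corson compacta in Hausdorff spaces are Corson compact. The family \<open>E\<close>, with
  coordinates outside \<open>E\<close> set to 0, embeds \<open>X\<close> as a compact set of points with countable support.
\<close>
theorem continuous_image_sigma_family:
  fixes f :: "'a::topological_space \<Rightarrow> 'k::t2_space"
  assumes X: "compact X" and E: "sigma_family X E" "separates E X" and f: "continuous_on X f"
  shows "\<exists>G. sigma_family (f ` X) G \<and> separates G (f ` X)"
proof -
  define e where "e x = (\<lambda>g. if g \<in> E then g x else 0)" for x
  have "continuous_on X (\<lambda>x. e x g)" for g
    using E(1) by (cases "g \<in> E") (auto simp: e_def sigma_family_def)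
  then have e: "continuous_on X e" by (rule continuous_on_coordinatewise_then_product)
  have inj: "inj_on e X"
  proof (rule inj_onI)
    fix x y assume xy: "x \<in> X" "y \<in> X" "e x = e y"
    have "g x = g y" if "g \<in> E" for g
      using fun_cong[OF xy(3), of g] that by (simp add: e_def)
    then show "x = y" using E(2) xy by (simp add: separates_def)
  qed
  have "compact (e ` X)" using e X by (rule compact_continuous_image)
  moreover have "countable {g. y g \<noteq> 0}" if y: "y \<in> e ` X" for y
  proof -
    obtain x where x: "x \<in> X" "y = e x" using y by blast
    have "{g. y g \<noteq> 0} = {g \<in> E. g x \<noteq> 0}" by (auto simp: x e_def)
    then show ?thesis using E(1) x by (simp add: sigma_family_def)
  qed
  moreover have "continuous_on (e ` X) (\<lambda>y. f (inv_into X e y))"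
    by (rule continuous_on_quotient[OF Hausdorff_space_fun X e])
      (use f in \<open>auto simp: inv_into_f_f[OF inj] elim: continuous_on_eq\<close>)
  moreover have "(\<lambda>y. f (inv_into X e y)) ` e ` X = f ` X"
    by (auto simp: inv_into_f_f[OF inj] image_image)
  ultimately show ?thesis using image_sigma_family[of "e ` X" "\<lambda>y. f (inv_into X e y)"] by simp
qed

section \<open>Points charged by the functionals of a positive embedding\<close>

lemma bump_function:
  fixes x :: "'k::t2_space"
  assumes K: "compact (UNIV :: 'k set)" and U: "open U" "x \<in> U"
  obtains b :: "'k \<Rightarrow> real" where "continuous_on UNIV b" "\<forall>z. 0 \<le> b z \<and> b z \<le> 1" "b x = 1"
    "\<forall>z. z \<notin> U \<longrightarrow> b z = 0"
proof -
  have "closed (- U)" "- U \<inter> {x} = {}" using U by auto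
  from compact_Urysohn[OF K this(1) subset_UNIV closed_singleton subset_UNIV this(2)]
  obtain b :: "'k \<Rightarrow> real" where "continuous_on UNIV b" "\<And>z. z \<in> UNIV \<Longrightarrow> 0 \<le> b z \<and> b z \<le> 1"
    "\<And>z. z \<in> - U \<Longrightarrow> b z = 0" "\<And>z. z \<in> {x} \<Longrightarrow> b z = 1"
    by metis
  then show thesis using that by auto
qed

lemma apply_Bcontfun_compact:
  fixes b :: "'k::topological_space \<Rightarrow> real"
  assumes "compact (UNIV :: 'k set)" "continuous_on UNIV b"
  shows "apply_bcontfun (Bcontfun b) = b"
proof -
  have "bounded (range b)" using assms by (intro compact_imp_bounded compact_continuous_image)
  then show ?thesis using assms by (intro Bcontfun_inverse) (simp add: bcontfun_def)
qed

text \<open>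
  The upper bound \<open>M\<close> limits the total mass of the functionals, and the lower bound \<open>m\<close> is the size
  of the atoms that are found below.
\<close>
locale positive_embedding =
  fixes T :: "('k::t2_space \<Rightarrow>\<^sub>C real) \<Rightarrow> ('l::t2_space \<Rightarrow>\<^sub>C real)" and m :: real and M :: real
  assumes compact_K: "compact (UNIV :: 'k set)" and compact_L: "compact (UNIV :: 'l set)"
    and linear: "linear T" and positive: "positive_operator T"
    and m_pos: "0 < m" and M_pos: "0 < M" and lower: "m * norm g \<le> norm (T g)" and upper: "norm (T g) \<le> M * norm g"
begin

lemma mono_T:
  assumes "\<And>z. apply_bcontfun g z \<le> apply_bcontfun h z"
  shows "apply_bcontfun (T g) y \<le> apply_bcontfun (T h) y"
proof -
  have "0 \<le> apply_bcontfun (T (h - g)) y"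
    using positive assms unfolding positive_operator_def by simp
  then show ?thesis by (simp add: linear_diff[OF linear])
qed

lemma attains_lower_bound:
  assumes "\<And>z. 0 \<le> apply_bcontfun q z" "1 \<le> apply_bcontfun q x"
  shows "\<exists>y. m \<le> apply_bcontfun (T q) y"
proof -
  obtain y where y: "\<And>y'. apply_bcontfun (T q) y' \<le> apply_bcontfun (T q) y"
    using continuous_attains_sup[OF compact_L, of "apply_bcontfun (T q)"] by auto
  have "0 \<le> apply_bcontfun (T q) y'" for y'
    using positive assms unfolding positive_operator_def by blast
  then have "norm (T q) \<le> apply_bcontfun (T q) y"
    using y by (intro norm_bound) simp
  moreover have "1 \<le> norm q" using assms(2) norm_bounded[of q x] by simp
  then have "m \<le> m * norm q" using m_pos by simp
  ultimately show ?thesis using lower[of q] by (intro exI[of _ y]) linarith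
qed

text \<open>
  The measure that represents the positive functional \<open>g \<mapsto> (T g)(y)\<close> has mass at least \<open>m\<close> at the
  point \<open>x\<close>. Stated with all nonnegative \<open>g\<close>, not only those with \<open>g x = 1\<close>, the condition is an
  intersection of closed conditions on \<open>(x, y)\<close>.
\<close>
definition charges :: "'l \<Rightarrow> 'k \<Rightarrow> bool" where
  "charges y x \<longleftrightarrow> (\<forall>g. (\<forall>z. 0 \<le> apply_bcontfun g z) \<longrightarrow> m * apply_bcontfun g x \<le> apply_bcontfun (T g) y)"

lemma closed_charges: "closed {(x, y). charges y x}"
proof -
  have "{(x, y). charges y x} =
      (\<Inter>g\<in>{g. \<forall>z. 0 \<le> apply_bcontfun g z}. {p. m * apply_bcontfun g (fst p) \<le> apply_bcontfun (T g) (snd p)})"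
    by (auto simp: charges_def)
  moreover have "closed {p. m * apply_bcontfun g (fst p) \<le> apply_bcontfun (T g) (snd p)}" for g
    by (intro closed_Collect_le continuous_intros continuous_on_compose2[OF continuous_on_apply_bcontfun])
      auto
  ultimately show ?thesis by auto
qed

text \<open>
  The set is a projection of a compact part of the graph of \<open>charges\<close>.
\<close>
lemma closed_charging:
  assumes "closed A"
  shows "closed {y. \<exists>x\<in>A. charges y x}"
proof -
  have "compact (UNIV :: ('k \<times> 'l) set)" using compact_Times[OF compact_K compact_L] by simp
  then have "compact ({(x, y). charges y x} \<inter> A \<times> UNIV)"
    using closed_charges assms by (metis closed_Int closed_Times closed_UNIV compact_Int_closed Int_UNIV_left)
  then have "compact (snd ` ({(x, y). charges y x} \<inter> A \<times> UNIV))"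
    by (intro compact_continuous_image continuous_intros)
  moreover have "snd ` ({(x, y). charges y x} \<inter> A \<times> UNIV) = {y. \<exists>x\<in>A. charges y x}" by force
  ultimately show ?thesis by (simp add: compact_imp_closed)
qed

lemma closed_charged:
  assumes "closed B"
  shows "closed {x. \<exists>y\<in>B. charges y x}"
proof -
  have "compact (UNIV :: ('k \<times> 'l) set)" using compact_Times[OF compact_K compact_L] by simp
  then have "compact ({(x, y). charges y x} \<inter> UNIV \<times> B)"
    using closed_charges assms by (metis closed_Int closed_Times closed_UNIV compact_Int_closed Int_UNIV_left)
  then have "compact (fst ` ({(x, y). charges y x} \<inter> UNIV \<times> B))"
    by (intro compact_continuous_image continuous_intros)
  moreover have "fst ` ({(x, y). charges y x} \<inter> UNIV \<times> B) = {x. \<exists>y\<in>B. charges y x}" by force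
  ultimately show ?thesis by (simp add: compact_imp_closed)
qed

text \<open>
  The functions \<open>q \<ge> 0\<close> with \<open>q x = 1\<close> have norm at least 1, so each set \<open>{y. m \<le> T q y}\<close> is nonempty.
  They are closed under pointwise minima and \<open>T\<close> is monotone, so these closed sets have the finite
  intersection property.
\<close>
lemma exists_charging: "\<exists>y. charges y x"
proof -
  define Q where "Q = {q :: 'k \<Rightarrow>\<^sub>C real. (\<forall>z. 0 \<le> apply_bcontfun q z) \<and> apply_bcontfun q x = 1}"
  define D where "D q = {y. m \<le> apply_bcontfun (T q) y}" for q
  have "closed (D q)" for q
    unfolding D_def by (intro closed_Collect_le continuous_intros) auto
  have below: "\<exists>q\<in>Q. \<forall>p\<in>F. \<forall>z. apply_bcontfun q z \<le> apply_bcontfun p z" if "finite F" "F \<subseteq> Q" for F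
    using that
  proof (induction F rule: finite_induct)
    case empty
    have "const_bcontfun 1 \<in> Q" by (simp add: Q_def const_bcontfun.rep_eq)
    then show ?case by blast
  next
    case (insert p F)
    then obtain q where q: "q \<in> Q" "\<forall>p\<in>F. \<forall>z. apply_bcontfun q z \<le> apply_bcontfun p z" by auto
    \<comment> \<open>The pointwise minimum is again admissible, as the value 1 at \<open>x\<close> is shared.\<close>
    define r where "r = Bcontfun (\<lambda>z. min (apply_bcontfun q z) (apply_bcontfun p z))"
    have r: "apply_bcontfun r = (\<lambda>z. min (apply_bcontfun q z) (apply_bcontfun p z))"
      unfolding r_def by (intro apply_Bcontfun_compact compact_K continuous_intros) auto
    have "r \<in> Q" using q(1) insert.prems by (auto simp: Q_def r)
    moreover have "\<forall>p'\<in>insert p F. \<forall>z. apply_bcontfun r z \<le> apply_bcontfun p' z"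
      using q(2) by (auto simp: r min_le_iff_disj)
    ultimately show ?case by blast
  qed
  have "UNIV \<inter> (\<Inter>q\<in>Q. D q) \<noteq> {}"
  proof (rule compact_imp_fip_image[OF compact_L])
    fix F assume F: "finite F" "F \<subseteq> Q"
    then obtain q where q: "q \<in> Q" "\<forall>p\<in>F. \<forall>z. apply_bcontfun q z \<le> apply_bcontfun p z"
      using below by blast
    obtain y where "m \<le> apply_bcontfun (T q) y" using attains_lower_bound[of q x] q(1) by (auto simp: Q_def)
    then have "y \<in> D p" if "p \<in> F" for p
      using q(2) that mono_T[of q p y] by (fastforce simp: D_def)
    then show "UNIV \<inter> (\<Inter>q\<in>F. D q) \<noteq> {}" by blast
  qed (use \<open>\<And>q. closed (D q)\<close> in auto)
  then obtain y where y: "\<And>q. q \<in> Q \<Longrightarrow> m \<le> apply_bcontfun (T q) y" by (auto simp: D_def)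
  have "m * apply_bcontfun g x \<le> apply_bcontfun (T g) y" if g: "\<forall>z. 0 \<le> apply_bcontfun g z" for g
  proof (cases "apply_bcontfun g x = 0")
    case True
    then show ?thesis using positive g unfolding positive_operator_def by simp
  next
    case False
    then have gx: "apply_bcontfun g x > 0" using g by (metis less_eq_real_def)
    have "inverse (apply_bcontfun g x) *\<^sub>R g \<in> Q" using g gx by (simp add: Q_def)
    from y[OF this] have "m \<le> inverse (apply_bcontfun g x) * apply_bcontfun (T g) y"
      by (simp add: linear_scale[OF linear])
    then show ?thesis using gx by (simp add: field_simps)
  qed
  then show ?thesis unfolding charges_def by blast
qed

text \<open>
  Zorn's lemma, applied to the complements of closed covering sets. The union of a chain of complements is again
  admissible: the functionals charging one point form a compact set, which would be contained in a
  single member of the chain if it were contained in the union. Minimality is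
  stated as it is used: removing an open set that meets \<open>L'\<close> leaves some point of \<open>U\<close> uncharged.
\<close>
lemma minimal_covering:
  assumes L: "closed L" "\<And>x. x \<in> U \<Longrightarrow> \<exists>y\<in>L. charges y x"
  obtains L' where "closed L'" "L' \<subseteq> L" "\<forall>x\<in>U. \<exists>y\<in>L'. charges y x"
    "\<forall>W. open W \<longrightarrow> W \<inter> L' \<noteq> {} \<longrightarrow> (\<exists>x\<in>U. \<forall>y\<in>L' - W. \<not> charges y x)"
proof -
  define \<V> where "\<V> = {V. open V \<and> - L \<subseteq> V \<and> (\<forall>x\<in>U. \<exists>y\<in>-V. charges y x)}"
  have "- L \<in> \<V>" using L by (auto simp: \<V>_def)
  have "\<exists>V\<in>\<V>. \<forall>V'\<in>\<V>. V \<subseteq> V' \<longrightarrow> V' = V"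
  proof (rule subset_Zorn_nonempty)
    show "\<V> \<noteq> {}" using \<open>- L \<in> \<V>\<close> by blast
    fix \<C> assume ne: "\<C> \<noteq> {}" and chain: "subset.chain \<V> \<C>"
    then have C: "\<And>V. V \<in> \<C> \<Longrightarrow> V \<in> \<V>" by (auto simp: subset_chain_def)
    have "\<exists>y\<in>- \<Union>\<C>. charges y x" if "x \<in> U" for x
    proof (rule ccontr)
      assume "\<not> ?thesis"
      then have sub: "{y. charges y x} \<subseteq> \<Union>\<C>" by blast
      have cpt: "compact {y. charges y x}"
        using closed_charging[of "{x}"] compact_Int_closed[OF compact_L, of "{y. charges y x}"] by simp
      have op: "\<And>V. V \<in> \<C> \<Longrightarrow> open V" using C by (auto simp: \<V>_def)
      obtain \<D> where D: "\<D> \<subseteq> \<C>" "finite \<D>" "{y. charges y x} \<subseteq> \<Union>\<D>"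
        by (rule compactE[OF cpt sub op])
      then have "\<exists>V\<in>\<C>. {y. charges y x} \<subseteq> V"
      proof (cases "\<D> = {}")
        case False
        have "X \<subseteq> Y \<or> Y \<subseteq> X" if "X \<in> \<D>" "Y \<in> \<D>" for X Y
          using chain D(1) that unfolding subset_chain_def by (meson subsetD)
        moreover have "\<D> \<subseteq> \<V>" using C D(1) by (auto dest: subsetD)
        ultimately have "subset.chain \<V> \<D>" by (simp add: subset_chain_def)
        then have "\<Union>\<D> \<in> \<D>" by (rule Union_in_chain[OF D(2) False])
        then have "\<Union>\<D> \<in> \<C>" using D(1) by (rule subsetD[rotated])
        then show ?thesis using D(3) by (rule bexI[rotated])
      qed (use ne in auto)
      then show False using C that by (auto simp: \<V>_def)
    qed
    moreover have "open (\<Union>\<C>)" using C by (auto simp: \<V>_def)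
    moreover have "- L \<subseteq> \<Union>\<C>" using C ne by (auto simp: \<V>_def)
    ultimately show "\<Union>\<C> \<in> \<V>" by (simp add: \<V>_def)
  qed
  then obtain V where V: "V \<in> \<V>" "\<And>V'. V' \<in> \<V> \<Longrightarrow> V \<subseteq> V' \<Longrightarrow> V' = V" by blast
  show thesis
  proof
    show "closed (- V)" "- V \<subseteq> L" using V(1) by (auto simp: \<V>_def)
    show "\<forall>x\<in>U. \<exists>y\<in>- V. charges y x" using V(1) by (auto simp: \<V>_def)
    show "\<forall>W. open W \<longrightarrow> W \<inter> - V \<noteq> {} \<longrightarrow> (\<exists>x\<in>U. \<forall>y\<in>- V - W. \<not> charges y x)"
    proof (intro allI impI)
      fix W assume W: "open W" "W \<inter> - V \<noteq> {}"
      then have "V \<union> W \<notin> \<V>" using V(2)[of "V \<union> W"] by blast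
      moreover have "open (V \<union> W)" "- L \<subseteq> V \<union> W" using V(1) W(1) by (auto simp: \<V>_def)
      ultimately show "\<exists>x\<in>U. \<forall>y\<in>- V - W. \<not> charges y x" by (auto simp: \<V>_def)
    qed
  qed
qed

lemma bump_bcontfun:
  fixes x :: 'k
  assumes "open U" "x \<in> U"
  obtains b :: "'k \<Rightarrow>\<^sub>C real" where "\<forall>z. 0 \<le> apply_bcontfun b z \<and> apply_bcontfun b z \<le> 1"
    "apply_bcontfun b x = 1" "\<forall>z. z \<notin> U \<longrightarrow> apply_bcontfun b z = 0"
proof -
  obtain b :: "'k \<Rightarrow> real" where b: "continuous_on UNIV b" "\<forall>z. 0 \<le> b z \<and> b z \<le> 1" "b x = 1"
    "\<forall>z. z \<notin> U \<longrightarrow> b z = 0"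
    by (rule bump_function[OF compact_K assms])
  show thesis
    by (rule that[of "Bcontfun b"]) (use b in \<open>simp_all add: apply_Bcontfun_compact[OF compact_K]\<close>)
qed

lemma charges_bump: "charges y x \<Longrightarrow> (\<And>z. 0 \<le> apply_bcontfun b z) \<Longrightarrow> apply_bcontfun b x = 1 \<Longrightarrow>
    m \<le> apply_bcontfun (T b) y"
  using spec[of _ b, OF charges_def[THEN iffD1]] by fastforce

section \<open>Open sets with Corson compact closure\<close>

text \<open>
  The last hypothesis says that the functionals from \<open>L\<close> have mass at most \<open>n m/2\<close> on \<open>U\<close>. For
  \<open>n = 0\<close> it contradicts that the points of \<open>U\<close> are charged. In the induction step either the claim holds
  already, or two points of \<open>U\<close> are charged by one functional of a minimal covering set. Passing to an open
  subset that avoids a neighbourhood of one of them, and to functionals that have mass at least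
  \<open>m/2\<close> on that neighbourhood, lowers the bound to \<open>(n - 1) m/2\<close>.
\<close>
lemma uniquely_charged_open_set:
  assumes "open U" "U \<noteq> {}" "closed L" "\<And>x. x \<in> U \<Longrightarrow> \<exists>y\<in>L. charges y x"
    and "\<And>g y. y \<in> L \<Longrightarrow> (\<And>z. 0 \<le> apply_bcontfun g z \<and> apply_bcontfun g z \<le> 1) \<Longrightarrow>
        (\<And>z. z \<notin> U \<Longrightarrow> apply_bcontfun g z = 0) \<Longrightarrow> apply_bcontfun (T g) y \<le> real n * (m / 2)"
  shows "\<exists>U' L'. open U' \<and> U' \<noteq> {} \<and> U' \<subseteq> U \<and> closed L' \<and> (\<forall>x\<in>U'. \<exists>y\<in>L'. charges y x) \<and>
    (\<forall>y\<in>L'. \<forall>x\<in>U'. \<forall>x'\<in>U'. charges y x \<longrightarrow> charges y x' \<longrightarrow> x = x')"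
  using assms
proof (induction n arbitrary: U L)
  case 0
  obtain x y where x: "x \<in> U" and y: "y \<in> L" "charges y x" using 0 by blast
  obtain b :: "'k \<Rightarrow>\<^sub>C real" where b: "\<forall>z. 0 \<le> apply_bcontfun b z \<and> apply_bcontfun b z \<le> 1"
    "apply_bcontfun b x = 1" "\<forall>z. z \<notin> U \<longrightarrow> apply_bcontfun b z = 0"
    by (rule bump_bcontfun[OF 0(1) x])
  have "m \<le> apply_bcontfun (T b) y" using charges_bump[OF y(2)] b by blast
  also have "\<dots> \<le> real 0 * (m / 2)" using 0(5)[OF y(1)] b by blast
  finally show ?case using m_pos by simp
next
  case (Suc n)
  obtain L' where L': "closed L'" "L' \<subseteq> L" "\<forall>x\<in>U. \<exists>y\<in>L'. charges y x"
    and min: "\<forall>W. open W \<longrightarrow> W \<inter> L' \<noteq> {} \<longrightarrow> (\<exists>x\<in>U. \<forall>y\<in>L' - W. \<not> charges y x)"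
    by (rule minimal_covering[OF Suc.prems(3,4)])
  show ?case
  proof (cases "\<forall>y\<in>L'. \<forall>x\<in>U. \<forall>x'\<in>U. charges y x \<longrightarrow> charges y x' \<longrightarrow> x = x'")
    case True
    then show ?thesis using Suc.prems(1,2) L' by blast
  next
    case False
    then obtain y x1 x2 where y: "y \<in> L'" "charges y x1" "charges y x2" and x: "x1 \<in> U" "x2 \<in> U" "x1 \<noteq> x2"
      by blast
    obtain V1 V2 where V: "open V1" "open V2" "x1 \<in> V1" "x2 \<in> V2" "V1 \<inter> V2 = {}"
      using hausdorff[OF x(3)] by blast
    define U1 U2 where "U1 = V1 \<inter> U" and "U2 = V2 \<inter> U"
    have U12: "open U1" "open U2" "x1 \<in> U1" "x2 \<in> U2" "U1 \<inter> U2 = {}" "U1 \<subseteq> U" "U2 \<subseteq> U"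
      using V x Suc.prems(1) by (auto simp: U1_def U2_def)
    obtain b1 :: "'k \<Rightarrow>\<^sub>C real" where b1: "\<forall>z. 0 \<le> apply_bcontfun b1 z \<and> apply_bcontfun b1 z \<le> 1"
      "apply_bcontfun b1 x1 = 1" "\<forall>z. z \<notin> U1 \<longrightarrow> apply_bcontfun b1 z = 0"
      by (rule bump_bcontfun[OF U12(1,3)])
    obtain b2 :: "'k \<Rightarrow>\<^sub>C real" where b2: "\<forall>z. 0 \<le> apply_bcontfun b2 z \<and> apply_bcontfun b2 z \<le> 1"
      "apply_bcontfun b2 x2 = 1" "\<forall>z. z \<notin> U2 \<longrightarrow> apply_bcontfun b2 z = 0"
      by (rule bump_bcontfun[OF U12(2,4)])
    \<comment> \<open>The strict inequalities make \<open>W\<close> open; the weak ones in \<open>L''\<close> below keep that set closed.\<close>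
    define W where "W = {y. m / 2 < apply_bcontfun (T b1) y} \<inter> {y. m / 2 < apply_bcontfun (T b2) y}"
    have "open W"
      unfolding W_def by (intro open_Int open_Collect_less continuous_intros) auto
    have "m \<le> apply_bcontfun (T b1) y" "m \<le> apply_bcontfun (T b2) y"
      using charges_bump[OF y(2)] charges_bump[OF y(3)] b1 b2 by blast+
    then have "y \<in> W" using m_pos by (simp add: W_def)
    then obtain x0 where x0: "x0 \<in> U" "\<forall>y\<in>L' - W. \<not> charges y x0"
      using min \<open>open W\<close> y(1) by blast
    define U0 where "U0 = U - {x. \<exists>y\<in>L' - W. charges y x}"
    have "closed (L' - W)" using L'(1) \<open>open W\<close> by (rule closed_Diff)
    then have "open U0" unfolding U0_def using Suc.prems(1) closed_charged by (intro open_Diff)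
    have "x0 \<in> U0" using x0 by (auto simp: U0_def)
    define L'' where "L'' = L' \<inter> {y. m / 2 \<le> apply_bcontfun (T b1) y} \<inter> {y. m / 2 \<le> apply_bcontfun (T b2) y}"
    have "closed L''"
      unfolding L''_def by (intro closed_Int L' closed_Collect_le continuous_intros) auto
    have cover: "\<exists>y\<in>L''. charges y x" if x: "x \<in> U0" for x
    proof -
      obtain y where "y \<in> L'" "charges y x" using x L'(3) unfolding U0_def by blast
      moreover from this have "y \<in> W" using x unfolding U0_def by blast
      ultimately show ?thesis by (intro bexI[of _ y]) (auto simp: L''_def W_def)
    qed
    \<comment> \<open>The neighbourhoods \<open>U1\<close> and \<open>U2\<close> are disjoint, so part of \<open>U0\<close> misses one of them; \<open>b\<close> is the bump on the one that is missed.\<close>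
    obtain U3 b where U3: "open U3" "U3 \<noteq> {}" "U3 \<subseteq> U0"
      and b: "\<And>z. 0 \<le> apply_bcontfun b z \<and> apply_bcontfun b z \<le> 1" "\<And>z. z \<in> U3 \<Longrightarrow> apply_bcontfun b z = 0"
        "\<And>z. z \<notin> U \<Longrightarrow> apply_bcontfun b z = 0" "\<And>y. y \<in> L'' \<Longrightarrow> m / 2 \<le> apply_bcontfun (T b) y"
    proof (cases "x0 \<in> closure U1")
      case True
      then have "U0 \<inter> U1 \<noteq> {}" using \<open>open U0\<close> \<open>x0 \<in> U0\<close> by (metis closure_iff_nhds_not_empty Int_commute order_refl)
      moreover have "z \<notin> U2" if "z \<in> U0 \<inter> U1" for z using that U12(5) by blast
      moreover have "z \<notin> U2" if "z \<notin> U" for z using that U12(7) by blast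
      ultimately show ?thesis
        using \<open>open U0\<close> U12(1) b2 by (intro that[of "U0 \<inter> U1" b2]) (auto simp: L''_def)
    next
      case False
      have "open (U0 - closure U1)" using \<open>open U0\<close> by auto
      moreover have "U0 - closure U1 \<noteq> {}" using False \<open>x0 \<in> U0\<close> by blast
      moreover have "z \<notin> U1" if "z \<in> U0 - closure U1" for z using that closure_subset by blast
      moreover have "z \<notin> U1" if "z \<notin> U" for z using that U12(6) by blast
      ultimately show ?thesis
        using b1 by (intro that[of "U0 - closure U1" b1]) (auto simp: L''_def)
    qed
    have "\<exists>U' L'. open U' \<and> U' \<noteq> {} \<and> U' \<subseteq> U3 \<and> closed L' \<and> (\<forall>x\<in>U'. \<exists>y\<in>L'. charges y x) \<and>
      (\<forall>y\<in>L'. \<forall>x\<in>U'. \<forall>x'\<in>U'. charges y x \<longrightarrow> charges y x' \<longrightarrow> x = x')"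
    proof (rule Suc.IH[OF U3(1,2) \<open>closed L''\<close>])
      show "\<exists>y\<in>L''. charges y x" if "x \<in> U3" for x using cover that U3(3) by blast
      fix g :: "'k \<Rightarrow>\<^sub>C real" and y assume yL: "y \<in> L''" and g: "\<And>z. 0 \<le> apply_bcontfun g z \<and> apply_bcontfun g z \<le> 1"
        "\<And>z. z \<notin> U3 \<Longrightarrow> apply_bcontfun g z = 0"
      \<comment> \<open>The supports of \<open>g\<close> and \<open>b\<close> are disjoint, so \<open>g + b\<close> is again a test function for the mass on \<open>U\<close>.\<close>
      have gb: "0 \<le> apply_bcontfun (g + b) z \<and> apply_bcontfun (g + b) z \<le> 1" for z
      proof (cases "z \<in> U3")
        case True
        then show ?thesis using g(1)[of z] b(2)[of z] by simp
      next
        case False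
        then show ?thesis using g(2)[of z] b(1)[of z] by simp
      qed
      have off: "apply_bcontfun (g + b) z = 0" if z: "z \<notin> U" for z
      proof -
        have "z \<notin> U3" using z U3(3) by (auto simp: U0_def)
        then show ?thesis using g(2)[of z] b(3)[OF z] by simp
      qed
      have "y \<in> L" using yL L'(2) by (auto simp: L''_def)
      from Suc.prems(5)[OF this gb off]
      have "apply_bcontfun (T g) y + apply_bcontfun (T b) y \<le> real (Suc n) * (m / 2)"
        by (simp add: linear_add[OF linear])
      then show "apply_bcontfun (T g) y \<le> real n * (m / 2)"
        using b(4)[OF yL] by (simp add: algebra_simps)
    qed
    then obtain U' L' where U': "open U'" "U' \<noteq> {}" "U' \<subseteq> U3" and L': "closed L'"
      "\<forall>x\<in>U'. \<exists>y\<in>L'. charges y x"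
      "\<forall>y\<in>L'. \<forall>x\<in>U'. \<forall>x'\<in>U'. charges y x \<longrightarrow> charges y x' \<longrightarrow> x = x'"
      by (elim exE conjE)
    have "U' \<subseteq> U" using U'(3) U3(3) by (auto simp: U0_def)
    then show ?thesis using U'(1,2) L' by (intro exI conjI)
  qed
qed

text \<open>
  Where the charged point is unique, it depends continuously on the functional, since its graph is
  closed in a compact space. Hence the closure of a slightly smaller open set is a continuous image
  of a compact subset of \<open>L\<close>.
\<close>
lemma locally_Corson:
  fixes V :: "'k set"
  assumes E: "sigma_family (UNIV :: 'l set) E" "separates E UNIV" and V: "open V" "V \<noteq> {}"
  shows "\<exists>U. open U \<and> U \<noteq> {} \<and> U \<subseteq> V \<and> Corson_compact (top_of_set (closure U))"
proof -
  obtain n where n: "M \<le> real n * (m / 2)"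
    using reals_Archimedean3[of "m / 2"] m_pos by (metis half_gt_zero less_imp_le)
  have "\<exists>U' L'. open U' \<and> U' \<noteq> {} \<and> U' \<subseteq> V \<and> closed L' \<and> (\<forall>x\<in>U'. \<exists>y\<in>L'. charges y x) \<and>
      (\<forall>y\<in>L'. \<forall>x\<in>U'. \<forall>x'\<in>U'. charges y x \<longrightarrow> charges y x' \<longrightarrow> x = x')"
  proof (rule uniquely_charged_open_set[OF V closed_UNIV])
    show "\<exists>y\<in>UNIV. charges y x" for x using exists_charging by simp
    fix g :: "'k \<Rightarrow>\<^sub>C real" and y :: 'l
    assume g: "\<And>z. 0 \<le> apply_bcontfun g z \<and> apply_bcontfun g z \<le> 1"
    have "norm g \<le> 1" using g by (intro norm_bound) simp
    have "apply_bcontfun (T g) y \<le> norm (T g)" using norm_bounded[of "T g" y] by simp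
    also have "\<dots> \<le> M * norm g" by (rule upper)
    also have "\<dots> \<le> M" using \<open>norm g \<le> 1\<close> M_pos by (simp add: mult_left_le)
    finally show "apply_bcontfun (T g) y \<le> real n * (m / 2)" using n by simp
  qed
  then obtain U' :: "'k set" and L' where U': "open U'" "U' \<noteq> {}" "U' \<subseteq> V" and L': "closed L'"
    and cover: "\<forall>x\<in>U'. \<exists>y\<in>L'. charges y x"
    and unique: "\<forall>y\<in>L'. \<forall>x\<in>U'. \<forall>x'\<in>U'. charges y x \<longrightarrow> charges y x' \<longrightarrow> x = x'"
    by blast
  obtain x0 where x0: "x0 \<in> U'" using U'(2) by blast
  obtain b :: "'k \<Rightarrow> real" where b: "continuous_on UNIV b" "\<forall>z. 0 \<le> b z \<and> b z \<le> 1" "b x0 = 1"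
    "\<forall>z. z \<notin> U' \<longrightarrow> b z = 0"
    by (rule bump_function[OF compact_K U'(1) x0])
  \<comment> \<open>A superlevel set of a bump has its closure inside \<open>U'\<close>, where charged points are unique.\<close>
  define U where "U = {z. 1 / 2 < b z}"
  have "open U" unfolding U_def using b(1) by (intro open_Collect_less continuous_intros)
  have "x0 \<in> U" using b(3) by (simp add: U_def)
  define C where "C = closure U"
  have "closed C" by (simp add: C_def)
  have "closed {z. 1 / 2 \<le> b z}" using b(1) by (intro closed_Collect_le continuous_intros)
  moreover have "U \<subseteq> {z. 1 / 2 \<le> b z}" by (auto simp: U_def)
  ultimately have "C \<subseteq> {z. 1 / 2 \<le> b z}" unfolding C_def by (rule closure_minimal[rotated])
  moreover have "z \<in> U'" if "1 / 2 \<le> b z" for z using b(4) that by (metis divide_le_0_1_iff not_numeral_le_zero)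
  ultimately have "C \<subseteq> U'" by blast
  \<comment> \<open>The functionals that charge a point of the closed set \<open>C\<close>; that point is then \<open>f y\<close>.\<close>
  define L0 where "L0 = L' \<inter> {y. \<exists>x\<in>C. charges y x}"
  define f where "f y = (SOME x. x \<in> C \<and> charges y x)" for y
  have f: "f y \<in> C \<and> charges y (f y)" if "y \<in> L0" for y
    unfolding f_def by (rule someI_ex) (use that in \<open>auto simp: L0_def\<close>)
  have f_eq: "f y = x" if "y \<in> L0" "x \<in> C" "charges y x" for x y
    using f[OF that(1)] that unique \<open>C \<subseteq> U'\<close> unfolding L0_def by blast
  have "closed L0" unfolding L0_def using L' closed_charging[OF \<open>closed C\<close>] by (rule closed_Int)
  then have "compact L0" using compact_Int_closed[OF compact_L, of L0] by simp
  have "continuous_on L0 f"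
    unfolding continuous_on_closed_invariant
  proof (intro allI impI)
    fix B :: "'k set" assume "closed B"
    then have "closed (L' \<inter> {y. \<exists>x\<in>C \<inter> B. charges y x})"
      using L' \<open>closed C\<close> by (intro closed_Int closed_charging)
    moreover have "(L' \<inter> {y. \<exists>x\<in>C \<inter> B. charges y x}) \<inter> L0 = f -` B \<inter> L0"
    proof (intro equalityI subsetI)
      fix y assume "y \<in> (L' \<inter> {y. \<exists>x\<in>C \<inter> B. charges y x}) \<inter> L0"
      then show "y \<in> f -` B \<inter> L0" using f_eq by auto
    next
      fix y assume "y \<in> f -` B \<inter> L0"
      then show "y \<in> (L' \<inter> {y. \<exists>x\<in>C \<inter> B. charges y x}) \<inter> L0" using f[of y] by (auto simp: L0_def)
    qed
    ultimately show "\<exists>A. closed A \<and> A \<inter> L0 = f -` B \<inter> L0" by blast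
  qed
  moreover have "f ` L0 = C"
  proof
    show "f ` L0 \<subseteq> C" using f by blast
    show "C \<subseteq> f ` L0"
    proof
      fix x assume x: "x \<in> C"
      then obtain y where y: "y \<in> L'" "charges y x" using cover \<open>C \<subseteq> U'\<close> by blast
      then have "y \<in> L0" using x by (auto simp: L0_def)
      then show "x \<in> f ` L0" using f_eq[OF _ x y(2)] by blast
    qed
  qed
  ultimately obtain G where "sigma_family C G" "separates G C"
    using continuous_image_sigma_family[OF \<open>compact L0\<close> sigma_family_subset[OF E(1)] separates_subset[OF E(2)], of f]
    by auto
  moreover have "compact C" using compact_Int_closed[OF compact_K \<open>closed C\<close>] by simp
  ultimately have "Corson_compact (top_of_set C)" by (intro sigma_family_imp_Corson_compact)
  moreover have "U \<subseteq> V" using \<open>C \<subseteq> U'\<close> U'(3) closure_subset[of U] by (auto simp: C_def)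
  ultimately show ?thesis using \<open>open U\<close> \<open>x0 \<in> U\<close> unfolding C_def by blast
qed

end

text \<open>
  Choose bump functions \<open>b\<close> supported in the given open sets so that finitely many of the sets
  \<open>{b \<noteq> 0}\<close> cover the space. The
  functions \<open>b\<close> and \<open>b g\<close> separate points: if all of them agree at \<open>z\<close> and \<open>z'\<close> and \<open>b z \<noteq> 0\<close>, then
  both points lie in the set belonging to \<open>b\<close>, and division by \<open>b z = b z'\<close> gives \<open>g z = g z'\<close> for its family.
\<close>
lemma sigma_family_of_local:
  assumes K: "compact (UNIV :: 'k::t2_space set)"
    and loc: "\<And>x::'k. \<exists>U G. open U \<and> x \<in> U \<and> sigma_family (closure U) G \<and> separates G (closure U)"
  shows "\<exists>G. sigma_family (UNIV :: 'k set) G \<and> separates G UNIV"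
proof -
  have "\<exists>U G b. open U \<and> sigma_family (closure U) G \<and> separates G (closure U) \<and>
      continuous_on UNIV b \<and> b x = 1 \<and> (\<forall>z. z \<notin> U \<longrightarrow> b z = (0::real))" for x :: 'k
  proof -
    obtain U G where U: "open U" "x \<in> U" "sigma_family (closure U) G" "separates G (closure U)"
      using loc by blast
    obtain b :: "'k \<Rightarrow> real" where "continuous_on UNIV b" "\<forall>z. 0 \<le> b z \<and> b z \<le> 1" "b x = 1"
      "\<forall>z. z \<notin> U \<longrightarrow> b z = 0"
      by (rule bump_function[OF K U(1,2)])
    then show ?thesis using U by blast
  qed
  then obtain U G b where U: "\<And>x::'k. open (U x)" "\<And>x. sigma_family (closure (U x)) (G x)"
      "\<And>x. separates (G x) (closure (U x))"
    and b: "\<And>x. continuous_on UNIV (b x)" "\<And>x. b x x = (1::real)" "\<And>x z. z \<notin> U x \<Longrightarrow> b x z = 0"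
    by metis
  have op: "open {z. b x z \<noteq> 0}" for x using b(1) by (intro open_Collect_neq continuous_intros)
  have "UNIV \<subseteq> (\<Union>x\<in>UNIV. {z. b x z \<noteq> 0})" using b(2) by (auto intro: exI[where x = "_ :: 'k"])
  then obtain F where F: "finite F" "UNIV \<subseteq> (\<Union>x\<in>F. {z. b x z \<noteq> 0})"
    using compactE_image[OF K, of UNIV "\<lambda>x. {z. b x z \<noteq> 0}"] op by auto
  define ext where "ext x g = (\<lambda>z. if z \<in> closure (U x) then b x z * g z else 0)" for x g
  define H where "H = (\<Union>x\<in>F. insert (b x) (ext x ` G x))"
  have b_off: "b x z = 0" if "z \<notin> U x" for x z using b(3) that by blast
  have "continuous_on UNIV (ext x g)" if g: "g \<in> G x" for x g
  proof -
    have "continuous_on (closure (U x)) g" using U(2)[of x] g by (simp add: sigma_family_def)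
    then have "continuous_on (closure (U x)) (\<lambda>z. b x z * g z)"
      by (intro continuous_on_mult continuous_on_subset[OF b(1)]) auto
    then have "continuous_on (closure (U x) \<union> - U x) (ext x g)"
      unfolding ext_def using U(1)[of x] closure_subset[of "U x"]
      by (intro continuous_on_cases) (auto simp: b_off)
    moreover have "closure (U x) \<union> - U x = UNIV" using closure_subset[of "U x"] by blast
    ultimately show ?thesis by simp
  qed
  then have "\<forall>h\<in>H. continuous_on UNIV h" using b(1) by (auto simp: H_def)
  moreover have "countable {h \<in> H. h z \<noteq> 0}" for z
  proof -
    have "countable ({b x} \<union> ext x ` {g \<in> G x. z \<in> closure (U x) \<and> g z \<noteq> 0})" for x
      using U(2)[of x] by (cases "z \<in> closure (U x)") (auto simp: sigma_family_def)
    then have "countable (\<Union>x\<in>F. {b x} \<union> ext x ` {g \<in> G x. z \<in> closure (U x) \<and> g z \<noteq> 0})"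
      using countable_finite[OF F(1)] by (intro countable_UN)
    moreover have "{h \<in> H. h z \<noteq> 0} \<subseteq> (\<Union>x\<in>F. {b x} \<union> ext x ` {g \<in> G x. z \<in> closure (U x) \<and> g z \<noteq> 0})"
      by (auto simp: H_def ext_def split: if_splits)
    ultimately show ?thesis by (rule countable_subset[rotated])
  qed
  moreover have "separates H UNIV"
    unfolding separates_def
  proof (intro ballI impI)
    fix z z' :: 'k assume eq: "\<forall>h\<in>H. h z = h z'"
    obtain x where x: "x \<in> F" "b x z \<noteq> 0" using F(2) by blast
    have bz: "b x z = b x z'" using eq x(1) by (auto simp: H_def)
    then have "z \<in> U x" "z' \<in> U x" using b_off x(2) by metis+
    then have zz: "z \<in> closure (U x)" "z' \<in> closure (U x)" using closure_subset by blast+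
    have "g z = g z'" if "g \<in> G x" for g
    proof -
      have "ext x g z = ext x g z'" using eq x(1) that by (auto simp: H_def)
      then show ?thesis using zz bz x(2) by (simp add: ext_def)
    qed
    then show "z = z'" using U(3)[of x] zz unfolding separates_def by blast
  qed
  ultimately show ?thesis unfolding sigma_family_def by blast
qed

lemma homogeneous_Corson:
  fixes U :: "'k::t2_space set"
  assumes K: "compact (UNIV :: 'k set)" and hom: "homogeneous_space (euclidean :: 'k topology)"
    and U: "open U" "U \<noteq> {}" "Corson_compact (top_of_set (closure U))"
  shows "Corson_compact (euclidean :: 'k topology)"
proof -
  obtain G where G: "sigma_family (closure U) G" "separates G (closure U)"
    using Corson_compact_imp_sigma_family[OF U(3)] by blast
  obtain x0 where "x0 \<in> U" using U(2) by blast
  have "\<exists>W H. open W \<and> x \<in> W \<and> sigma_family (closure W) H \<and> separates H (closure W)" for x :: 'k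
  proof -
    obtain \<theta> where \<theta>: "homeomorphic_map euclidean euclidean \<theta>" "\<theta> x = x0"
      using hom unfolding homogeneous_space_def by (metis UNIV_I topspace_euclidean)
    have cont: "continuous_on UNIV \<theta>" using homeomorphic_imp_continuous_map[OF \<theta>(1)] by simp
    have inj: "inj \<theta>" using homeomorphic_imp_injective_map[OF \<theta>(1)] by simp
    define W where "W = \<theta> -` U"
    have "open W" unfolding W_def using cont U(1) by (simp add: continuous_on_open_vimage)
    have "closed (\<theta> -` closure U)" using cont by (simp add: continuous_on_closed_vimage)
    then have sub: "closure W \<subseteq> \<theta> -` closure U"
      unfolding W_def by (intro closure_minimal vimage_mono closure_subset)
    define H where "H = (\<lambda>g z. g (\<theta> z)) ` G"
    have "sigma_family (closure W) H"
      unfolding sigma_family_def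
    proof (intro conjI ballI)
      fix h assume "h \<in> H"
      then obtain g where g: "g \<in> G" "h = (\<lambda>z. g (\<theta> z))" by (auto simp: H_def)
      show "continuous_on (closure W) h"
        unfolding g(2)
        by (rule continuous_on_compose2[of "closure U" g])
          (use G(1) g(1) sub continuous_on_subset[OF cont] in \<open>auto simp: sigma_family_def\<close>)
    next
      fix z assume "z \<in> closure W"
      then have "countable {g \<in> G. g (\<theta> z) \<noteq> 0}" using G(1) sub by (auto simp: sigma_family_def)
      moreover have "{h \<in> H. h z \<noteq> 0} \<subseteq> (\<lambda>g z. g (\<theta> z)) ` {g \<in> G. g (\<theta> z) \<noteq> 0}" by (auto simp: H_def)
      ultimately show "countable {h \<in> H. h z \<noteq> 0}" by (meson countable_image countable_subset)
    qed
    moreover have "separates H (closure W)"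
      unfolding separates_def
    proof (intro ballI impI)
      fix z z' assume z: "z \<in> closure W" "z' \<in> closure W" and "\<forall>h\<in>H. h z = h z'"
      then have "\<forall>g\<in>G. g (\<theta> z) = g (\<theta> z')" by (auto simp: H_def)
      moreover have "\<theta> z \<in> closure U" "\<theta> z' \<in> closure U" using z sub by auto
      ultimately have "\<theta> z = \<theta> z'" using G(2) unfolding separates_def by blast
      then show "z = z'" using inj by (simp add: inj_eq)
    qed
    moreover have "x \<in> W" using \<theta>(2) \<open>x0 \<in> U\<close> by (simp add: W_def)
    ultimately show ?thesis using \<open>open W\<close> by blast
  qed
  from sigma_family_of_local[OF K this] obtain H where "sigma_family (UNIV :: 'k set) H" "separates H UNIV"
    by blast
  then show ?thesis using sigma_family_imp_Corson_compact[OF K] by simp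
qed

theorem corollary4p7:
  fixes T :: "('k::t2_space \<Rightarrow>\<^sub>C real) \<Rightarrow> ('l::t2_space \<Rightarrow>\<^sub>C real)"
  assumes "compact (UNIV :: 'k set)"
    and "compact (UNIV :: 'l set)"
    and "isomorphic_embedding T"
    and "positive_operator T"
    and "Corson_compact (euclidean :: 'l topology)"
  shows "(\<exists>\<B>. pi_base (euclidean :: 'k topology) \<B> \<and>
            (\<forall>U\<in>\<B>. Corson_compact (subtopology euclidean (closure U)))) \<and>
         (homogeneous_space (euclidean :: 'k topology) \<longrightarrow>
            Corson_compact (euclidean :: 'k topology))"
proof -
  obtain m M :: real where "0 < m" "0 < M" "\<And>g. m * norm g \<le> norm (T g)" "\<And>g. norm (T g) \<le> M * norm g"
    using assms(3) unfolding isomorphic_embedding_def by blast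
  then have "positive_embedding T m M"
    using assms(1-4) by (intro positive_embedding.intro) (auto simp: isomorphic_embedding_def)
  then interpret positive_embedding T m M .
  obtain E where E: "sigma_family (UNIV :: 'l set) E" "separates E UNIV"
    using Corson_compact_imp_sigma_family[of "UNIV :: 'l set"] assms(5) by auto
  note small = locally_Corson[OF E]
  define \<B> where "\<B> = {U :: 'k set. open U \<and> U \<noteq> {} \<and> Corson_compact (top_of_set (closure U))}"
  have "pi_base euclidean \<B>"
    unfolding pi_base_def
  proof (intro conjI ballI allI impI)
    fix V :: "'k set" assume "openin euclidean V \<and> V \<noteq> {}"
    then obtain U where "open U" "U \<noteq> {}" "U \<subseteq> V" "Corson_compact (top_of_set (closure U))"
      using small[of V] by auto
    then show "\<exists>U\<in>\<B>. U \<subseteq> V" by (auto simp: \<B>_def)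
  qed (auto simp: \<B>_def)
  moreover have "\<forall>U\<in>\<B>. Corson_compact (subtopology euclidean (closure U))" by (simp add: \<B>_def)
  moreover have "Corson_compact (euclidean :: 'k topology)" if "homogeneous_space (euclidean :: 'k topology)"
  proof -
    obtain U :: "'k set" where "open U" "U \<noteq> {}" "Corson_compact (top_of_set (closure U))"
      using small[OF open_UNIV UNIV_not_empty] by blast
    then show ?thesis by (rule homogeneous_Corson[OF assms(1) that])
  qed
  ultimately show ?thesis by blast
qed

end
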